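(* Let $\mathbb{K}$ be a field, $R=\mathbb{K}[X_1,\ldots,X_n]$ the standard graded polynomial ring, and $I\subset R$ a homogeneous ideal. Let $r=\operatorname{reg}(R/I)$ and let $i$ be the unique non-negative integer such that $\beta_{i,i+r}(R/I)$ is an extremal Betti number. Then for every integer $m\ge 2$, $$\operatorname{reg}(R/I^{[m]})=mr+(m-1)i,$$ where $I^{[m]}$ is the $m$-th square power of $I$. Furthermore, if $\operatorname{char}(\mathbb{K})=p>0$, then for every integer $e\ge 1$, $\operatorname{reg}(R/I^{[p^e]})=p^e r+(p^e-1)i$, where here $I^{[p^e]}$ denotes the $p^e$-th Frobenius power of $I$.
   Context: For $f\in R$ and a positive integer $m$, $f^{[m]}:=f(X_1^m,\ldots,X_n^m)$, and the $m$-th square power of an ideal $I\subset R$ is the ideal $I^{[m]}:=\langle f^{[m]} : f\in I\rangle$ of $R$. If $\operatorname{char}(\mathbb{K})=p>0$, the $p^e$-th Frobenius power of $I$ is the ideal generated by $\{f^{p^e}: f\in I\}$. The graded Betti numbers are $\beta_{i,j}(R/I)=\dim_{\mathbb{K}}\operatorname{Tor}_i^R(\mathbb{K},R/I)_j$. The (Castelnuovo–Mumford) regularity is $\operatorname{reg}(R/I)=\max\{j-i : \beta_{i,j}(R/I)\ne 0\}$. A nonzero graded Betti number $\beta_{i,j}(R/I)$ is called extremal if $\beta_{k,l}(R/I)=0$ for all pairs $(k,l)\neq(i,j)$ with $k\ge i$ and $l\ge j$.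
   Formalization: An i with β_{i,i+r}(R/I) extremal need not exist, e.g. for I=(x1^2,x1x2,x1x3,x1x4,x2^3) in four variables (r=2, β_{3,4} and β_{4,5} nonzero); the existence of such an i is therefore assumed, while its uniqueness is proved. *)

theory Defs
  imports "HOL-Library.Poly_Mapping" "HOL-Library.Extended_Real"
begin

section \<open>The polynomial ring\<close>

text \<open>The variables are indexed by a finite type \<open>'n\<close>, so \<open>n = CARD('n)\<close>; a polynomial is a
  finitely supported map from exponent vectors to coefficients.\<close>

type_synonym ('n, 'k) mpoly = "('n \<Rightarrow>\<^sub>0 nat) \<Rightarrow>\<^sub>0 'k"

definition Const :: "'k \<Rightarrow> ('n, 'k::field) mpoly" where
  "Const c = Poly_Mapping.single 0 c"

definition Var :: "'n \<Rightarrow> ('n, 'k::field) mpoly" where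
  "Var x = Poly_Mapping.single (Poly_Mapping.single x 1) 1"

definition subst :: "('n::finite \<Rightarrow> ('n, 'k::field) mpoly) \<Rightarrow> ('n, 'k) mpoly \<Rightarrow> ('n, 'k) mpoly" where
  "subst g f = (\<Sum>t\<in>Poly_Mapping.keys f.
     Const (Poly_Mapping.lookup f t) * (\<Prod>x\<in>UNIV. g x ^ Poly_Mapping.lookup t x))"

definition mdeg :: "('n::finite \<Rightarrow>\<^sub>0 nat) \<Rightarrow> nat" where
  "mdeg t = (\<Sum>x\<in>UNIV. Poly_Mapping.lookup t x)"

text \<open>Degrees are integers, and there is no nonzero form of negative degree.\<close>

definition form :: "int \<Rightarrow> ('n::finite, 'k::field) mpoly \<Rightarrow> bool" where
  "form d f \<longleftrightarrow> (\<forall>t\<in>Poly_Mapping.keys f. int (mdeg t) = d)"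

definition hom_component :: "nat \<Rightarrow> ('n::finite, 'k::field) mpoly \<Rightarrow> ('n, 'k) mpoly" where
  "hom_component d f = (\<Sum>t\<in>{t\<in>Poly_Mapping.keys f. mdeg t = d}.
     Poly_Mapping.single t (Poly_Mapping.lookup f t))"

text \<open>Ideals are the submodules of the ring acting on itself by multiplication.\<close>

definition homogeneous_ideal :: "('n::finite, 'k::field) mpoly set \<Rightarrow> bool" where
  "homogeneous_ideal I \<longleftrightarrow> module.subspace (*) I \<and> (\<forall>f\<in>I. \<forall>d. hom_component d f \<in> I)"

definition square_power :: "nat \<Rightarrow> ('n::finite, 'k::field) mpoly set \<Rightarrow> ('n, 'k) mpoly set" where
  "square_power m I = module.span (*) {subst (\<lambda>x. Var x ^ m) f | f. f \<in> I}"

definition frobenius_power :: "nat \<Rightarrow> ('n::finite, 'k::field) mpoly set \<Rightarrow> ('n, 'k) mpoly set" where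
  "frobenius_power q I = module.span (*) {f ^ q | f. f \<in> I}"


section \<open>Graded free resolutions\<close>

text \<open>A vector \<open>v :: 'b \<Rightarrow>\<^sub>0 'r\<close> stands for \<open>\<Sum>b. v\<^sub>b e\<^sub>b\<close>. The operations below are used both for
  \<open>'r\<close> the polynomial ring and for \<open>'r\<close> the base field.\<close>

definition free_module :: "'b set \<Rightarrow> ('b \<Rightarrow>\<^sub>0 'r::comm_ring_1) set" where
  "free_module B = {v. Poly_Mapping.keys v \<subseteq> B}"

definition smult_vec :: "'r::comm_ring_1 \<Rightarrow> ('b \<Rightarrow>\<^sub>0 'r) \<Rightarrow> ('b \<Rightarrow>\<^sub>0 'r)" where
  "smult_vec a v = Poly_Mapping.map ((*) a) v"

definition lin_ext :: "('b \<Rightarrow> ('c \<Rightarrow>\<^sub>0 'r::comm_ring_1)) \<Rightarrow> ('b \<Rightarrow>\<^sub>0 'r) \<Rightarrow> ('c \<Rightarrow>\<^sub>0 'r)" where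
  "lin_ext \<phi> v = (\<Sum>b\<in>Poly_Mapping.keys v. smult_vec (Poly_Mapping.lookup v b) (\<phi> b))"

text \<open>\<open>\<Oplus>\<^sub>b R(-\<delta> b)\<close>: the generator \<open>e\<^sub>b\<close> has degree \<open>\<delta> b\<close>.\<close>

definition form_vec :: "('b \<Rightarrow> int) \<Rightarrow> int \<Rightarrow> ('b \<Rightarrow>\<^sub>0 ('n::finite, 'k::field) mpoly) \<Rightarrow> bool" where
  "form_vec \<delta> d v \<longleftrightarrow> (\<forall>b. form (d - \<delta> b) (Poly_Mapping.lookup v b))"

text \<open>A complex \<open>\<cdots> \<rightarrow> F\<^sub>1 \<rightarrow> F\<^sub>0 \<rightarrow> R/I\<close> of free modules with homogeneous bases. \<open>F\<^sub>i\<close> has basis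
  \<open>{e\<^sub>b | b \<in> basis F i}\<close> with \<open>e\<^sub>b\<close> in degree \<open>gdeg F i b\<close>; \<open>diff F i b\<close> is the image of the basis
  vector \<open>e\<^sub>b\<close> of \<open>F\<^bsub>i+1\<^esub>\<close> in \<open>F\<^sub>i\<close> (mind the shift); \<open>aug F b\<close> is a representative in \<open>R\<close> of the
  image of the basis vector \<open>e\<^sub>b\<close> of \<open>F\<^sub>0\<close> in \<open>R/I\<close>. Bases are countable, possibly infinite.\<close>

record (overloaded) ('n, 'k) free_complex =
  basis :: "nat \<Rightarrow> nat set"
  gdeg :: "nat \<Rightarrow> nat \<Rightarrow> int"
  diff :: "nat \<Rightarrow> nat \<Rightarrow> (nat \<Rightarrow>\<^sub>0 ('n, 'k) mpoly)"
  aug :: "nat \<Rightarrow> ('n, 'k) mpoly"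

definition diff_map ::
  "('n::finite, 'k::field) free_complex \<Rightarrow> nat \<Rightarrow> (nat \<Rightarrow>\<^sub>0 ('n, 'k) mpoly) \<Rightarrow> (nat \<Rightarrow>\<^sub>0 ('n, 'k) mpoly)"
  where "diff_map F i = lin_ext (diff F i)"

definition aug_map ::
  "('n::finite, 'k::field) free_complex \<Rightarrow> (nat \<Rightarrow>\<^sub>0 ('n, 'k) mpoly) \<Rightarrow> ('n, 'k) mpoly"
  where "aug_map F v = (\<Sum>b\<in>Poly_Mapping.keys v. Poly_Mapping.lookup v b * aug F b)"

definition graded_free_resolution ::
  "('n::finite, 'k::field) mpoly set \<Rightarrow> ('n, 'k) free_complex \<Rightarrow> bool" where
  "graded_free_resolution I F \<longleftrightarrow>
     (\<forall>b\<in>basis F 0. form (gdeg F 0 b) (aug F b)) \<and>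
     (\<forall>i. \<forall>b\<in>basis F (Suc i). diff F i b \<in> free_module (basis F i) \<and>
        form_vec (gdeg F i) (gdeg F (Suc i) b) (diff F i b)) \<and>
     (\<forall>f. \<exists>v\<in>free_module (basis F 0). f - aug_map F v \<in> I) \<and>
     {v \<in> free_module (basis F 0). aug_map F v \<in> I} = diff_map F 0 ` free_module (basis F 1) \<and>
     (\<forall>i. {v \<in> free_module (basis F (Suc i)). diff_map F i v = 0} =
        diff_map F (Suc i) ` free_module (basis F (Suc (Suc i))))"


section \<open>Graded Betti numbers and regularity\<close>

text \<open>\<open>Tor\<^sub>i(K, R/I)\<close> is the homology of \<open>K \<otimes>\<^sub>R F\<close> for a graded free resolution \<open>F\<close> of \<open>R/I\<close>, where
  \<open>K = R/(X\<^sub>1,\<dots>,X\<^sub>n)\<close>. The degree \<open>j\<close> part of \<open>K \<otimes>\<^sub>R F\<^sub>i\<close> is the \<open>K\<close>-space on the generators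
  \<open>1 \<otimes> e\<^sub>b\<close> of degree \<open>j\<close>, and \<open>1 \<otimes> d\<close> is given by the constant terms of the entries of \<open>d\<close>.\<close>

definition tensor_part :: "('n::finite, 'k::field) free_complex \<Rightarrow> nat \<Rightarrow> int \<Rightarrow> (nat \<Rightarrow>\<^sub>0 'k) set" where
  "tensor_part F i j = free_module {b \<in> basis F i. gdeg F i b = j}"

definition tensor_diff ::
  "('n::finite, 'k::field) free_complex \<Rightarrow> nat \<Rightarrow> (nat \<Rightarrow>\<^sub>0 'k) \<Rightarrow> (nat \<Rightarrow>\<^sub>0 'k)" where
  "tensor_diff F i =
     lin_ext (\<lambda>b. Poly_Mapping.map (\<lambda>f. Poly_Mapping.lookup f 0) (diff F i b))"

definition tor_cycles :: "('n::finite, 'k::field) free_complex \<Rightarrow> nat \<Rightarrow> int \<Rightarrow> (nat \<Rightarrow>\<^sub>0 'k) set" where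
  "tor_cycles F i j =
     (case i of 0 \<Rightarrow> tensor_part F 0 j
      | Suc i' \<Rightarrow> {v \<in> tensor_part F (Suc i') j. tensor_diff F i' v = 0})"

definition tor_boundaries :: "('n::finite, 'k::field) free_complex \<Rightarrow> nat \<Rightarrow> int \<Rightarrow> (nat \<Rightarrow>\<^sub>0 'k) set" where
  "tor_boundaries F i j = tensor_diff F i ` tensor_part F (Suc i) j"

text \<open>\<open>B\<close> consists of representatives of a basis of \<open>V/W\<close>. As for \<^const>\<open>vector_space.dim\<close>,
  an infinite dimension is recorded as \<open>0\<close>; for \<open>Tor\<^sub>i(K, R/I)\<close> this does not occur.\<close>

definition quotient_basis :: "('b \<Rightarrow>\<^sub>0 'k::field) set \<Rightarrow> ('b \<Rightarrow>\<^sub>0 'k) set \<Rightarrow> ('b \<Rightarrow>\<^sub>0 'k) set \<Rightarrow> bool" where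
  "quotient_basis V W B \<longleftrightarrow>
     B \<subseteq> V \<and>
     (\<forall>S u. finite S \<and> S \<subseteq> B \<and> (\<Sum>b\<in>S. smult_vec (u b) b) \<in> W \<longrightarrow> (\<forall>b\<in>S. u b = 0)) \<and>
     (\<forall>v\<in>V. \<exists>S u. finite S \<and> S \<subseteq> B \<and> v - (\<Sum>b\<in>S. smult_vec (u b) b) \<in> W)"

definition quotient_dim :: "('b \<Rightarrow>\<^sub>0 'k::field) set \<Rightarrow> ('b \<Rightarrow>\<^sub>0 'k) set \<Rightarrow> nat" where
  "quotient_dim V W = card (SOME B. quotient_basis V W B)"

text \<open>\<open>betti I i j\<close> is \<open>\<beta>\<^bsub>i,j\<^esub>(R/I)\<close>. \<open>Tor\<close> does not depend on the resolution, so any one is chosen.\<close>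

definition betti :: "('n::finite, 'k::field) mpoly set \<Rightarrow> nat \<Rightarrow> int \<Rightarrow> nat" where
  "betti I i j = (let F = (SOME F. graded_free_resolution I F)
     in quotient_dim (tor_cycles F i j) (tor_boundaries F i j))"

text \<open>\<open>regularity I\<close> is \<open>reg(R/I)\<close>. The maximum is taken in the extended reals, where
  \<open>reg 0 = -\<infinity>\<close>; a finite supremum of a set of integers is attained.\<close>

definition regularity :: "('n::finite, 'k::field) mpoly set \<Rightarrow> ereal" where
  "regularity I = Sup {ereal (real_of_int (j - int i)) | i j. betti I i j \<noteq> 0}"

text \<open>Here \<open>l\<close> is compared with \<open>j\<close> as an internal degree, not as a row index \<open>l - k\<close> of the Betti table.\<close>

definition extremal_betti :: "('n::finite, 'k::field) mpoly set \<Rightarrow> nat \<Rightarrow> int \<Rightarrow> bool" where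
  "extremal_betti I i j \<longleftrightarrow> betti I i j \<noteq> 0 \<and>
     (\<forall>k l. k \<ge> i \<and> l \<ge> j \<and> (k, l) \<noteq> (i, j) \<longrightarrow> betti I k l = 0)"

end

theory Submission
  imports Defs "HOL-Computational_Algebra.Primes"
begin

text \<open>Everything follows from one statement about Betti numbers. Let \<open>\<sigma>\<close> be an endomorphism of the
  field \<open>K\<close>, let \<open>m > 0\<close>, and let \<open>\<psi>\<close> be the ring endomorphism
  \<open>\<Sum>\<^sub>t c\<^sub>t X\<^sup>t \<mapsto> \<Sum>\<^sub>t \<sigma>(c\<^sub>t) X\<^bsup>mt\<^esup>\<close> of \<open>R\<close>. If \<open>J\<close> is the ideal generated by \<open>\<psi>(I)\<close>, then
  \<open>\<beta>\<^bsub>i,l\<^esub>(R/J) \<noteq> 0\<close> holds exactly when \<open>l = m j\<close> for some \<open>j\<close> with \<open>\<beta>\<^bsub>i,j\<^esub>(R/I) \<noteq> 0\<close>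
  (\<open>betti_nonzero_extended\<close>). The square power is the case \<open>\<sigma> = id\<close>. The Frobenius power is the case
  \<open>m = p\<^sup>e\<close>, \<open>\<sigma>(c) = c\<^sup>m\<close>, because then \<open>\<psi>(f) = f\<^sup>m\<close> in characteristic \<open>p\<close>
  (\<open>power_eq_power_map\<close>).

  The statement holds because \<open>\<psi>\<close> is flat. Dividing exponents by \<open>m\<close> with remainder shows that the
  monomials \<open>b X\<^sup>a\<close>, where \<open>b\<close> runs through a basis of \<open>K\<close> over \<open>\<sigma>(K)\<close> and all entries of \<open>a\<close> are
  below \<open>m\<close>, form a basis of \<open>R\<close> over \<open>\<psi>(R)\<close> (\<open>power_map_projective_extension\<close>). A linear system over
  \<open>\<psi>(R)\<close> is therefore solved coordinate by coordinate, and applying \<open>\<psi>\<close> to a graded free resolution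
  of \<open>R/I\<close> yields one of \<open>R/J\<close>, with all degrees multiplied by \<open>m\<close> (\<open>extend_resolution\<close>).
  After tensoring with \<open>K\<close>, the old and the new complex differ by base change along \<open>\<sigma>\<close>, and the same
  argument for fields shows that the homology of one vanishes if and only if that of the other does.

  Betti numbers are defined through an unspecified resolution, so two general facts are proved as
  well. First, Tor is independent of the resolution: chain maps exist by lifting, and a chain map
  over the zero map of \<open>R/I\<close> is homotopic to zero (\<open>tor_surjective\<close>). Second, a homogeneous ideal
  has a resolution with finitely many generators in each degree: the generators of the next module
  are bases of the graded pieces of the syzygies (\<open>resolution_exists\<close>). It makes every Tor finite
  dimensional, so that a Betti number vanishes only if Tor does (\<open>betti_nonzero_iff\<close>).

  It remains to maximize \<open>m l - k\<close> over the pairs \<open>(k, l)\<close> with \<open>\<beta>\<^bsub>k,l\<^esub>(R/I) \<noteq> 0\<close>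
  (\<open>regularity_extended\<close>). If \<open>k \<le> i\<close>, then \<open>m l - k = m (l - k) + (m - 1) k\<close> is at most
  \<open>m r + (m - 1) i\<close>. If \<open>k > i\<close>, then extremality of \<open>\<beta>\<^bsub>i,i+r\<^esub>\<close> forces \<open>l < i + r\<close>, and \<open>m l - k\<close>
  is smaller than \<open>m (i + r) - i\<close>, which is the same bound.\<close>

section \<open>Linear maps between free modules\<close>

lemma lookup_smult_vec [simp]:
  "Poly_Mapping.lookup (smult_vec a v) b = a * Poly_Mapping.lookup v b"
  by (simp add: smult_vec_def map.rep_eq when_def)

lemma lookup_lin_ext:
  assumes "finite A" "Poly_Mapping.keys v \<subseteq> A"
  shows "Poly_Mapping.lookup (lin_ext \<phi> v) c =
    (\<Sum>b\<in>A. Poly_Mapping.lookup v b * Poly_Mapping.lookup (\<phi> b) c)"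
proof -
  have "Poly_Mapping.lookup (lin_ext \<phi> v) c =
    (\<Sum>b\<in>Poly_Mapping.keys v. Poly_Mapping.lookup v b * Poly_Mapping.lookup (\<phi> b) c)"
    by (simp add: lin_ext_def lookup_sum)
  also have "\<dots> = (\<Sum>b\<in>A. Poly_Mapping.lookup v b * Poly_Mapping.lookup (\<phi> b) c)"
    by (rule sum.mono_neutral_left) (use assms in \<open>auto simp: in_keys_iff\<close>)
  finally show ?thesis .
qed

lemma lin_ext_zero [simp]: "lin_ext \<phi> 0 = 0"
  by (simp add: lin_ext_def)

lemma lin_ext_add: "lin_ext \<phi> (v + w) = lin_ext \<phi> v + lin_ext \<phi> w"
proof (rule poly_mapping_eqI)
  fix c
  let ?A = "Poly_Mapping.keys v \<union> Poly_Mapping.keys w"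
  have "Poly_Mapping.keys (v + w) \<subseteq> ?A" by (rule keys_add)
  then show "Poly_Mapping.lookup (lin_ext \<phi> (v + w)) c = Poly_Mapping.lookup (lin_ext \<phi> v + lin_ext \<phi> w) c"
    by (simp add: lookup_add lookup_lin_ext[of ?A] sum.distrib algebra_simps)
qed

lemma lin_ext_smult: "lin_ext \<phi> (smult_vec a v) = smult_vec a (lin_ext \<phi> v)"
proof (rule poly_mapping_eqI)
  fix c
  have "Poly_Mapping.keys (smult_vec a v) \<subseteq> Poly_Mapping.keys v"
    by (auto simp: in_keys_iff)
  then show "Poly_Mapping.lookup (lin_ext \<phi> (smult_vec a v)) c = Poly_Mapping.lookup (smult_vec a (lin_ext \<phi> v)) c"
    by (simp add: lookup_lin_ext[of "Poly_Mapping.keys v"] sum_distrib_left mult.assoc)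
qed

lemma lin_ext_uminus: "lin_ext \<phi> (- v) = - lin_ext \<phi> v"
  using lin_ext_add[of \<phi> v "- v"] by (simp add: eq_neg_iff_add_eq_0 add.commute)

lemma lin_ext_diff: "lin_ext \<phi> (v - w) = lin_ext \<phi> v - lin_ext \<phi> w"
  using lin_ext_add[of \<phi> v "- w"] by (simp add: lin_ext_uminus)

lemma lin_ext_sum: "lin_ext \<phi> (sum f S) = (\<Sum>s\<in>S. lin_ext \<phi> (f s))"
  by (induction S rule: infinite_finite_induct) (auto simp: lin_ext_add)

lemma lin_ext_single [simp]: "lin_ext \<phi> (Poly_Mapping.single b 1) = \<phi> b"
  by (rule poly_mapping_eqI) (simp add: lookup_lin_ext[of "{b}"])

lemma lin_ext_lin_ext: "lin_ext \<phi> (lin_ext \<chi> v) = lin_ext (\<lambda>b. lin_ext \<phi> (\<chi> b)) v"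
  unfolding lin_ext_def[of \<chi> v] lin_ext_def[of "\<lambda>b. lin_ext \<phi> (\<chi> b)" v]
  by (simp add: lin_ext_sum lin_ext_smult)

lemma lin_ext_id: "lin_ext (\<lambda>b. Poly_Mapping.single b 1) v = v"
  by (rule poly_mapping_eqI)
     (simp add: lookup_lin_ext[of "Poly_Mapping.keys v"] lookup_single when_def in_keys_iff if_distrib[of "(*) _"] cong: if_cong)

lemma sum_single: "(\<Sum>t\<in>Poly_Mapping.keys f. Poly_Mapping.single t (Poly_Mapping.lookup f t)) = f"
proof (rule poly_mapping_eqI)
  fix s
  have "Poly_Mapping.lookup (\<Sum>t\<in>Poly_Mapping.keys f. Poly_Mapping.single t (Poly_Mapping.lookup f t)) s =
      (\<Sum>t\<in>Poly_Mapping.keys f. if t = s then Poly_Mapping.lookup f s else 0)"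
    unfolding lookup_sum by (intro sum.cong) (auto simp: lookup_single)
  then show "Poly_Mapping.lookup (\<Sum>t\<in>Poly_Mapping.keys f. Poly_Mapping.single t (Poly_Mapping.lookup f t)) s = Poly_Mapping.lookup f s"
    by (simp add: in_keys_iff)
qed

lemma lin_ext_map_diff: "lin_ext (\<lambda>b. \<phi> b - \<chi> b) v = lin_ext \<phi> v - lin_ext \<chi> v"
  by (rule poly_mapping_eqI)
     (simp add: lookup_lin_ext[of "Poly_Mapping.keys v"] lookup_minus sum_subtractf algebra_simps)

lemma lin_ext_cong:
  assumes "v \<in> free_module B" "\<And>b. b \<in> B \<Longrightarrow> \<phi> b = \<chi> b"
  shows "lin_ext \<phi> v = lin_ext \<chi> v"
  using assms unfolding lin_ext_def free_module_def by (intro sum.cong) auto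

lemma free_module_lookup: "v \<in> free_module B \<longleftrightarrow> (\<forall>b. b \<notin> B \<longrightarrow> Poly_Mapping.lookup v b = 0)"
  by (auto simp: free_module_def in_keys_iff)

lemma free_module_zero [simp]: "0 \<in> free_module B"
  and free_module_single [simp]: "b \<in> B \<Longrightarrow> Poly_Mapping.single b a \<in> free_module B"
  and free_module_add [intro]: "v \<in> free_module B \<Longrightarrow> w \<in> free_module B \<Longrightarrow> v + w \<in> free_module B"
  and free_module_diff [intro]: "v \<in> free_module B \<Longrightarrow> w \<in> free_module B \<Longrightarrow> v - w \<in> free_module B"
  and free_module_smult [intro]: "v \<in> free_module B \<Longrightarrow> smult_vec a v \<in> free_module B"
  by (auto simp: free_module_lookup lookup_add lookup_minus lookup_single when_def)

lemma free_module_sum: "(\<And>s. s \<in> S \<Longrightarrow> f s \<in> free_module B) \<Longrightarrow> sum f S \<in> free_module B"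
  by (induction S rule: infinite_finite_induct) auto

lemma free_module_lin_ext:
  assumes "v \<in> free_module B" "\<And>b. b \<in> B \<Longrightarrow> \<phi> b \<in> free_module C"
  shows "lin_ext \<phi> v \<in> free_module C"
  unfolding lin_ext_def using assms
  by (intro free_module_sum free_module_smult) (auto simp: free_module_def)

lemma smult_vec_alg:
  "smult_vec a (v + w) = smult_vec a v + smult_vec a w"
  "smult_vec (a + b) v = smult_vec a v + smult_vec b v"
  "smult_vec a (smult_vec b v) = smult_vec (a * b) v"
  "smult_vec 1 v = v"
  by (auto intro!: poly_mapping_eqI simp: lookup_add algebra_simps)

lemma smult_vec_zero [simp]: "smult_vec a 0 = 0"
  by (rule poly_mapping_eqI) simp

section \<open>Change of coefficients\<close>

definition ring_hom :: "('r::comm_ring_1 \<Rightarrow> 's::comm_ring_1) \<Rightarrow> bool" where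
  "ring_hom h \<longleftrightarrow> h 1 = 1 \<and> (\<forall>a b. h (a + b) = h a + h b) \<and> (\<forall>a b. h (a * b) = h a * h b)"

lemma ring_homD:
  assumes "ring_hom h"
  shows "h 0 = 0" "h 1 = 1" "h (a + b) = h a + h b" "h (a * b) = h a * h b"
    "h (a - b) = h a - h b" "h (sum f S) = (\<Sum>s\<in>S. h (f s))"
proof -
  show add: "h (a + b) = h a + h b" for a b using assms by (simp add: ring_hom_def)
  show "h 1 = 1" "h (a * b) = h a * h b" using assms by (auto simp: ring_hom_def)
  show z: "h 0 = 0" using add[of 0 0] by simp
  show "h (a - b) = h a - h b" using add[of "a - b" b] by (simp add: algebra_simps)
  show "h (sum f S) = (\<Sum>s\<in>S. h (f s))"
    by (induction S rule: infinite_finite_induct) (auto simp: z add)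
qed

lemma lookup_map: "h 0 = 0 \<Longrightarrow> Poly_Mapping.lookup (Poly_Mapping.map h v) b = h (Poly_Mapping.lookup v b)"
  by (simp add: map.rep_eq when_def)

lemma map_free_module: "h 0 = 0 \<Longrightarrow> v \<in> free_module B \<Longrightarrow> Poly_Mapping.map h v \<in> free_module B"
  by (auto simp: free_module_lookup lookup_map)

text \<open>Changing coefficients commutes with applying a matrix. This is used for three ring
  homomorphisms: the constant term, the power map \<open>\<psi>\<close>, and the field endomorphism \<open>\<sigma>\<close>.\<close>

lemma map_lin_ext:
  assumes "ring_hom h"
  shows "Poly_Mapping.map h (lin_ext \<phi> v) = lin_ext (\<lambda>b. Poly_Mapping.map h (\<phi> b)) (Poly_Mapping.map h v)"
proof (rule poly_mapping_eqI)
  fix c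
  have h: "h 0 = 0" by (rule ring_homD[OF assms])
  have "Poly_Mapping.keys (Poly_Mapping.map h v) \<subseteq> Poly_Mapping.keys v"
    by (auto simp: in_keys_iff lookup_map h)
  then show "Poly_Mapping.lookup (Poly_Mapping.map h (lin_ext \<phi> v)) c =
    Poly_Mapping.lookup (lin_ext (\<lambda>b. Poly_Mapping.map h (\<phi> b)) (Poly_Mapping.map h v)) c"
    by (simp add: lookup_lin_ext[of "Poly_Mapping.keys v"] lookup_map h ring_homD[OF assms])
qed

lemma map_minus: "ring_hom h \<Longrightarrow>
    Poly_Mapping.map h (v - w) = Poly_Mapping.map h v - Poly_Mapping.map h w"
  by (rule poly_mapping_eqI) (simp add: lookup_map lookup_minus ring_homD)

section \<open>Ideals and their extensions\<close>

lemma module_mult: "module ((*) :: 'r::comm_ring_1 \<Rightarrow> 'r \<Rightarrow> 'r)"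
  by unfold_locales (auto simp: algebra_simps)

definition is_ideal :: "'r::comm_ring_1 set \<Rightarrow> bool" where
  "is_ideal I \<longleftrightarrow> 0 \<in> I \<and> (\<forall>x\<in>I. \<forall>y\<in>I. x + y \<in> I) \<and> (\<forall>c. \<forall>x\<in>I. c * x \<in> I)"

lemma subspace_iff_ideal: "module.subspace (*) I \<longleftrightarrow> is_ideal I"
  by (simp add: module.subspace_def[OF module_mult] is_ideal_def)

lemma ideal_diff: "is_ideal I \<Longrightarrow> x \<in> I \<Longrightarrow> y \<in> I \<Longrightarrow> x - y \<in> I"
  using is_ideal_def[of I] by (metis diff_conv_add_uminus mult_minus1)

lemma ideal_sum: "is_ideal I \<Longrightarrow> (\<And>s. s \<in> S \<Longrightarrow> f s \<in> I) \<Longrightarrow> sum f S \<in> I"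
  by (induction S rule: infinite_finite_induct) (auto simp: is_ideal_def)

definition extended_ideal :: "('r::comm_ring_1 \<Rightarrow> 'r) \<Rightarrow> 'r set \<Rightarrow> 'r set" where
  "extended_ideal \<psi> I = module.span (*) (\<psi> ` I)"

lemma extended_ideal_is_ideal: "is_ideal (extended_ideal \<psi> I)"
  unfolding extended_ideal_def subspace_iff_ideal[symmetric] by (rule module.subspace_span[OF module_mult])

lemma extended_ideal_base: "f \<in> I \<Longrightarrow> \<psi> f \<in> extended_ideal \<psi> I"
  unfolding extended_ideal_def by (intro module.span_base[OF module_mult] imageI)

section \<open>Descent along projective ring extensions\<close>

text \<open>Dual basis data: when the ring acts on itself through \<open>\<psi>\<close>, the maps \<open>\<pi> j\<close> are linear and every
  element is the combination of the \<open>e j\<close> with coefficients \<open>\<pi> j\<close>. In this form the flatness of \<open>\<psi>\<close>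
  can be applied to free modules of infinite rank, whose vectors still have only finitely many
  nonzero coordinates.\<close>

locale projective_extension =
  fixes \<psi> :: "'r::comm_ring_1 \<Rightarrow> 'r" and e :: "'j \<Rightarrow> 'r" and \<pi> :: "'j \<Rightarrow> 'r \<Rightarrow> 'r"
  assumes hom: "ring_hom \<psi>"
    and coord_add: "\<pi> j (f + g) = \<pi> j f + \<pi> j g"
    and coord_mult: "\<pi> j (\<psi> f * g) = f * \<pi> j g"
    and coord_finite: "finite {j. \<pi> j g \<noteq> 0}"
    and coord_expand: "g = (\<Sum>j | \<pi> j g \<noteq> 0. e j * \<psi> (\<pi> j g))"
begin

lemma coord_zero: "\<pi> j 0 = 0"
  using coord_add[of j 0 0] by simp

lemma coord_sum: "\<pi> j (sum f S) = (\<Sum>s\<in>S. \<pi> j (f s))"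
  by (induction S rule: infinite_finite_induct) (auto simp: coord_zero coord_add)

lemma coord_expand': "finite J \<Longrightarrow> {j. \<pi> j g \<noteq> 0} \<subseteq> J \<Longrightarrow> (\<Sum>j\<in>J. e j * \<psi> (\<pi> j g)) = g"
  by (subst (2) coord_expand[of g], rule sum.mono_neutral_right)
     (auto simp: ring_homD[OF hom])

lemma coord_lin_ext:
  "Poly_Mapping.map (\<pi> j) (lin_ext (\<lambda>b. Poly_Mapping.map \<psi> (\<phi> b)) v) = lin_ext \<phi> (Poly_Mapping.map (\<pi> j) v)"
proof (rule poly_mapping_eqI)
  fix c
  have "Poly_Mapping.keys (Poly_Mapping.map (\<pi> j) v) \<subseteq> Poly_Mapping.keys v"
    by (auto simp: in_keys_iff lookup_map coord_zero)
  moreover have "\<pi> j (a * \<psi> b) = \<pi> j a * b" for a b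
    using coord_mult[of j b a] by (simp add: mult.commute)
  ultimately show "Poly_Mapping.lookup (Poly_Mapping.map (\<pi> j) (lin_ext (\<lambda>b. Poly_Mapping.map \<psi> (\<phi> b)) v)) c =
      Poly_Mapping.lookup (lin_ext \<phi> (Poly_Mapping.map (\<pi> j) v)) c"
    by (simp add: lookup_lin_ext[of "Poly_Mapping.keys v"] lookup_map coord_zero ring_homD[OF hom] coord_sum)
qed

lemma expand_vec:
  obtains J where "finite J" "v = (\<Sum>j\<in>J. smult_vec (e j) (Poly_Mapping.map \<psi> (Poly_Mapping.map (\<pi> j) v)))"
proof -
  define J where "J = (\<Union>b\<in>Poly_Mapping.keys v. {j. \<pi> j (Poly_Mapping.lookup v b) \<noteq> 0})"
  have fin: "finite J" unfolding J_def using coord_finite by auto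
  have sub: "{j. \<pi> j (Poly_Mapping.lookup v b) \<noteq> 0} \<subseteq> J" for b
    by (cases "b \<in> Poly_Mapping.keys v") (auto simp: J_def in_keys_iff coord_zero)
  show thesis
  proof (rule that[OF fin])
    show "v = (\<Sum>j\<in>J. smult_vec (e j) (Poly_Mapping.map \<psi> (Poly_Mapping.map (\<pi> j) v)))"
      by (rule poly_mapping_eqI)
        (simp add: lookup_sum lookup_map coord_zero ring_homD[OF hom] coord_expand'[OF fin sub])
  qed
qed

text \<open>Solutions of a linear system for the single coordinates recombine, with the weights \<open>e j\<close>, to a
  solution of the system with coefficients moved by \<open>\<psi>\<close>. Exactness is preserved for this reason.\<close>

lemma image_if_coords:
  assumes "\<And>j. Poly_Mapping.map (\<pi> j) v \<in> lin_ext \<phi> ` free_module B"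
  shows "v \<in> lin_ext (\<lambda>b. Poly_Mapping.map \<psi> (\<phi> b)) ` free_module B"
proof -
  from assms have "\<forall>j. \<exists>w. w \<in> free_module B \<and> Poly_Mapping.map (\<pi> j) v = lin_ext \<phi> w" by blast
  then obtain w where w: "\<And>j. w j \<in> free_module B" "\<And>j. Poly_Mapping.map (\<pi> j) v = lin_ext \<phi> (w j)"
    by metis
  obtain J where J: "finite J"
    "v = (\<Sum>j\<in>J. smult_vec (e j) (Poly_Mapping.map \<psi> (Poly_Mapping.map (\<pi> j) v)))"
    by (rule expand_vec)
  let ?u = "\<Sum>j\<in>J. smult_vec (e j) (Poly_Mapping.map \<psi> (w j))"
  have "v = lin_ext (\<lambda>b. Poly_Mapping.map \<psi> (\<phi> b)) ?u"
    by (subst J(2)) (simp add: w(2) map_lin_ext[OF hom] lin_ext_sum lin_ext_smult)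
  moreover have "?u \<in> free_module B"
    by (intro free_module_sum free_module_smult map_free_module w ring_homD[OF hom])
  ultimately show ?thesis by blast
qed

lemma eq_0_iff_coords: "f = 0 \<longleftrightarrow> (\<forall>j. \<pi> j f = 0)"
proof
  assume "\<forall>j. \<pi> j f = 0"
  then have "(\<Sum>j | \<pi> j f \<noteq> 0. e j * \<psi> (\<pi> j f)) = 0" by simp
  then show "f = 0" by (simp only: coord_expand[of f, symmetric])
qed (simp add: coord_zero)

lemma vec_eq_0_iff_coords: "v = 0 \<longleftrightarrow> (\<forall>j. Poly_Mapping.map (\<pi> j) v = 0)"
proof
  assume z: "\<forall>j. Poly_Mapping.map (\<pi> j) v = 0"
  have "Poly_Mapping.lookup v b = 0" for b
    unfolding eq_0_iff_coords[of "Poly_Mapping.lookup v b"] lookup_map[of "\<pi> _", OF coord_zero, symmetric]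
    using z by simp
  then show "v = 0" by (simp add: poly_mapping_eqI)
qed (auto intro!: poly_mapping_eqI simp: lookup_map coord_zero)

lemma free_module_iff_coords: "v \<in> free_module B \<longleftrightarrow> (\<forall>j. Poly_Mapping.map (\<pi> j) v \<in> free_module B)"
proof
  assume v: "\<forall>j. Poly_Mapping.map (\<pi> j) v \<in> free_module B"
  have "Poly_Mapping.lookup v b = 0" if "b \<notin> B" for b
    unfolding eq_0_iff_coords[of "Poly_Mapping.lookup v b"]
    using v that by (auto simp: free_module_lookup lookup_map coord_zero)
  then show "v \<in> free_module B" by (simp add: free_module_lookup)
qed (simp add: map_free_module coord_zero)

lemma lin_ext_image_iff_coords:
  "v \<in> lin_ext (\<lambda>b. Poly_Mapping.map \<psi> (\<phi> b)) ` free_module B \<longleftrightarrow>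
    (\<forall>j. Poly_Mapping.map (\<pi> j) v \<in> lin_ext \<phi> ` free_module B)"
proof
  assume "v \<in> lin_ext (\<lambda>b. Poly_Mapping.map \<psi> (\<phi> b)) ` free_module B"
  then obtain u where u: "u \<in> free_module B" "v = lin_ext (\<lambda>b. Poly_Mapping.map \<psi> (\<phi> b)) u" by auto
  have "Poly_Mapping.map (\<pi> j) u \<in> free_module B" for j using u(1) free_module_iff_coords by blast
  then show "\<forall>j. Poly_Mapping.map (\<pi> j) v \<in> lin_ext \<phi> ` free_module B"
    unfolding u(2) coord_lin_ext by blast
next
  assume "\<forall>j. Poly_Mapping.map (\<pi> j) v \<in> lin_ext \<phi> ` free_module B"
  then show "v \<in> lin_ext (\<lambda>b. Poly_Mapping.map \<psi> (\<phi> b)) ` free_module B" by (intro image_if_coords) blast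
qed

lemma kernel_iff_coords:
  "lin_ext (\<lambda>b. Poly_Mapping.map \<psi> (\<phi> b)) v = 0 \<longleftrightarrow> (\<forall>j. lin_ext \<phi> (Poly_Mapping.map (\<pi> j) v) = 0)"
  by (subst vec_eq_0_iff_coords) (simp only: coord_lin_ext)

text \<open>The \<open>j\<close>-th coordinate of \<open>c * \<psi> g\<close> is the multiple \<open>\<pi> j c * g\<close> of \<open>g\<close>; conversely an element is a
  combination of the images of its coordinates.\<close>

lemma extended_ideal_iff_coords:
  assumes "is_ideal I"
  shows "f \<in> extended_ideal \<psi> I \<longleftrightarrow> (\<forall>j. \<pi> j f \<in> I)"
proof
  assume "f \<in> extended_ideal \<psi> I"
  then show "\<forall>j. \<pi> j f \<in> I"
    unfolding extended_ideal_def
  proof (induction rule: module.span_induct_alt[OF module_mult, consumes 1, case_names base step])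
    case base
    then show ?case using assms by (simp add: coord_zero is_ideal_def)
  next
    case (step c x y)
    then obtain g where g: "g \<in> I" "x = \<psi> g" by auto
    show ?case
    proof
      fix j
      have "\<pi> j (c * x + y) = \<pi> j c * g + \<pi> j y"
        using coord_mult[of j g c] by (simp add: coord_add g(2) mult.commute)
      then show "\<pi> j (c * x + y) \<in> I" using assms g(1) step by (simp add: is_ideal_def)
    qed
  qed
next
  assume f: "\<forall>j. \<pi> j f \<in> I"
  have "e j * \<psi> (\<pi> j f) \<in> extended_ideal \<psi> I" for j
    using extended_ideal_base[of "\<pi> j f" I \<psi>] f extended_ideal_is_ideal[of \<psi> I] by (simp add: is_ideal_def)
  then have "(\<Sum>j | \<pi> j f \<noteq> 0. e j * \<psi> (\<pi> j f)) \<in> extended_ideal \<psi> I"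
    by (intro ideal_sum extended_ideal_is_ideal)
  then show "f \<in> extended_ideal \<psi> I" by (simp only: coord_expand[of f, symmetric])
qed

end

section \<open>Homogeneous components\<close>

lemma lookup_hom_component:
  "Poly_Mapping.lookup (hom_component d f) t = (if mdeg t = d then Poly_Mapping.lookup f t else 0)"
proof -
  have "Poly_Mapping.lookup (hom_component d f) t =
      (\<Sum>s\<in>{t\<in>Poly_Mapping.keys f. mdeg t = d}. if s = t then Poly_Mapping.lookup f t else 0)"
    unfolding hom_component_def lookup_sum
    by (intro sum.cong) (auto simp: lookup_single)
  also have "\<dots> = (if mdeg t = d then Poly_Mapping.lookup f t else 0)"
    by (auto simp: in_keys_iff)
  finally show ?thesis .
qed

text \<open>The generators of a free module shift degrees, so that components are also taken in negative
  degrees, where they vanish.\<close>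

definition hcomp :: "int \<Rightarrow> ('n::finite, 'k::field) mpoly \<Rightarrow> ('n, 'k) mpoly" where
  "hcomp d f = (if d < 0 then 0 else hom_component (nat d) f)"

lemma lookup_hcomp:
  "Poly_Mapping.lookup (hcomp d f) t = (if int (mdeg t) = d then Poly_Mapping.lookup f t else 0)"
  by (auto simp: hcomp_def lookup_hom_component)

lemma form_iff_hcomp: "form d f \<longleftrightarrow> hcomp d f = f"
  by (force simp: form_def poly_mapping_eq_iff fun_eq_iff lookup_hcomp in_keys_iff)

lemma form_hcomp: "form d (hcomp d f)"
  by (auto simp: form_def in_keys_iff lookup_hcomp split: if_splits)

lemma hcomp_other_form: "form d f \<Longrightarrow> hcomp d' f = (if d' = d then f else 0)"
  by (rule poly_mapping_eqI) (auto simp: form_def lookup_hcomp in_keys_iff)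

lemma hcomp_zero [simp]: "hcomp d 0 = 0"
  and hcomp_add: "hcomp d (f + g) = hcomp d f + hcomp d g"
  and hcomp_diff: "hcomp d (f - g) = hcomp d f - hcomp d g"
  by (auto intro!: poly_mapping_eqI simp: lookup_hcomp lookup_add lookup_minus)

lemma hcomp_sum: "hcomp d (sum f S) = (\<Sum>s\<in>S. hcomp d (f s))"
  by (induction S rule: infinite_finite_induct) (auto simp: hcomp_add)

lemma sum_hcomp: "(\<Sum>d\<in>(int \<circ> mdeg) ` Poly_Mapping.keys f. hcomp d f) = f"
proof (rule poly_mapping_eqI)
  fix t
  show "Poly_Mapping.lookup (\<Sum>d\<in>(int \<circ> mdeg) ` Poly_Mapping.keys f. hcomp d f) t = Poly_Mapping.lookup f t"
    by (auto simp: lookup_sum lookup_hcomp in_keys_iff)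
qed

lemma mdeg_add: "mdeg (s + t) = mdeg s + mdeg t"
  by (simp add: mdeg_def lookup_add sum.distrib)

lemma form_mult: "form d f \<Longrightarrow> form d' g \<Longrightarrow> form (d + d') (f * g)"
  using keys_mult[of f g] by (fastforce simp: form_def mdeg_add)

text \<open>Both sides are additive in \<open>f\<close>, and the claim is clear when \<open>f\<close> is itself a form.\<close>

lemma hcomp_mult_form:
  assumes "form d a"
  shows "hcomp e (f * a) = hcomp (e - d) f * a"
proof -
  let ?D = "(int \<circ> mdeg) ` Poly_Mapping.keys f"
  have "hcomp e (f * a) = (\<Sum>d'\<in>?D. hcomp e (hcomp d' f * a))"
    by (subst sum_hcomp[of f, symmetric]) (simp only: sum_distrib_right hcomp_sum)
  also have "\<dots> = (\<Sum>d'\<in>?D. hcomp (e - d) (hcomp d' f) * a)"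
  proof (intro sum.cong refl)
    fix d'
    show "hcomp e (hcomp d' f * a) = hcomp (e - d) (hcomp d' f) * a"
      using hcomp_other_form[OF form_mult[OF form_hcomp[of d' f] assms], of e]
        hcomp_other_form[OF form_hcomp[of d' f], of "e - d"] by auto
  qed
  also have "\<dots> = hcomp (e - d) f * a"
    by (subst (3) sum_hcomp[of f, symmetric]) (simp only: sum_distrib_right hcomp_sum)
  finally show ?thesis .
qed

lemma form_lookup_0: "form d f \<Longrightarrow> d \<noteq> 0 \<Longrightarrow> Poly_Mapping.lookup f 0 = 0"
  by (force simp: form_def in_keys_iff mdeg_def[of 0])

lemma form_diff: "form d f \<Longrightarrow> form d g \<Longrightarrow> form d (f - g)"
  by (simp add: form_iff_hcomp hcomp_diff)

definition hcomp_vec :: "('b \<Rightarrow> int) \<Rightarrow> int \<Rightarrow> ('b \<Rightarrow>\<^sub>0 ('n::finite, 'k::field) mpoly) \<Rightarrow> ('b \<Rightarrow>\<^sub>0 ('n, 'k) mpoly)" where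
  "hcomp_vec \<delta> d v = Poly_Mapping.mapp (\<lambda>b. hcomp (d - \<delta> b)) v"

lemma lookup_hcomp_vec: "Poly_Mapping.lookup (hcomp_vec \<delta> d v) b = hcomp (d - \<delta> b) (Poly_Mapping.lookup v b)"
  by (auto simp: hcomp_vec_def lookup_mapp when_def in_keys_iff)

lemma form_vec_iff_hcomp: "form_vec \<delta> d v \<longleftrightarrow> hcomp_vec \<delta> d v = v"
  by (auto simp: form_vec_def form_iff_hcomp poly_mapping_eq_iff fun_eq_iff lookup_hcomp_vec)

lemma form_vec_hcomp: "form_vec \<delta> d (hcomp_vec \<delta> d v)"
  by (simp add: form_vec_def lookup_hcomp_vec form_hcomp)

lemma hcomp_vec_free_module: "v \<in> free_module B \<Longrightarrow> hcomp_vec \<delta> d v \<in> free_module B"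
  by (auto simp: free_module_lookup lookup_hcomp_vec)

lemma hcomp_vec_lin_ext:
  assumes v: "v \<in> free_module B" and \<phi>: "\<And>b. b \<in> B \<Longrightarrow> form_vec \<delta> (\<delta>' b) (\<phi> b)"
  shows "hcomp_vec \<delta> d (lin_ext \<phi> v) = lin_ext \<phi> (hcomp_vec \<delta>' d v)"
proof (rule poly_mapping_eqI)
  fix c
  let ?A = "Poly_Mapping.keys v"
  have sub: "Poly_Mapping.keys (hcomp_vec \<delta>' d v) \<subseteq> ?A"
    by (auto simp: hcomp_vec_def keys_mapp_subset[THEN subsetD])
  have "hcomp (d - \<delta> c) (Poly_Mapping.lookup v b * Poly_Mapping.lookup (\<phi> b) c) =
      hcomp (d - \<delta>' b) (Poly_Mapping.lookup v b) * Poly_Mapping.lookup (\<phi> b) c" if "b \<in> ?A" for b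
  proof -
    have "form (\<delta>' b - \<delta> c) (Poly_Mapping.lookup (\<phi> b) c)"
      using v \<phi>[of b] that by (auto simp: form_vec_def free_module_def)
    from hcomp_mult_form[OF this] show ?thesis by simp
  qed
  then show "Poly_Mapping.lookup (hcomp_vec \<delta> d (lin_ext \<phi> v)) c =
      Poly_Mapping.lookup (lin_ext \<phi> (hcomp_vec \<delta>' d v)) c"
    using sub by (simp add: lookup_hcomp_vec lookup_lin_ext[of ?A] hcomp_sum)
qed

lemma form_vec_lin_ext:
  assumes "v \<in> free_module B" "\<And>b. b \<in> B \<Longrightarrow> form_vec \<delta> (\<delta>' b) (\<phi> b)" "form_vec \<delta>' d v"
  shows "form_vec \<delta> d (lin_ext \<phi> v)"
  using assms(3) unfolding form_vec_iff_hcomp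
  by (simp add: hcomp_vec_lin_ext[where \<delta>'=\<delta>' and B=B, OF assms(1,2)])

lemma form_vec_diff: "form_vec \<delta> d v \<Longrightarrow> form_vec \<delta> d w \<Longrightarrow> form_vec \<delta> d (v - w)"
  by (simp add: form_vec_def lookup_minus form_diff)

lemma form_vec_single: "form_vec \<delta> (\<delta> b) (Poly_Mapping.single b 1)"
  by (auto simp: form_vec_def lookup_single when_def form_def mdeg_def)

lemma homogeneous_ideal_iff: "homogeneous_ideal I \<longleftrightarrow> is_ideal I \<and> (\<forall>f\<in>I. \<forall>d. hcomp d f \<in> I)"
proof -
  have "(\<forall>f\<in>I. \<forall>d. hom_component d f \<in> I) \<longleftrightarrow> (\<forall>f\<in>I. \<forall>d. hcomp d f \<in> I)" if "is_ideal I"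
  proof (intro ball_cong refl iffI allI)
    fix f d assume "\<forall>d. hcomp d f \<in> I"
    then have "hcomp (int d) f \<in> I" by blast
    then show "hom_component d f \<in> I" by (simp add: hcomp_def)
  next
    fix f d assume "\<forall>d. hom_component d f \<in> I"
    then show "hcomp d f \<in> I" using that by (simp add: hcomp_def is_ideal_def)
  qed
  then show ?thesis by (auto simp: homogeneous_ideal_def subspace_iff_ideal)
qed

section \<open>Syzygies and homogeneous lifts\<close>

text \<open>The vectors of \<open>F\<^sub>i\<close> that the resolution has to hit from \<open>F\<^bsub>i+1\<^esub>\<close>. Treating \<open>i = 0\<close> alike, with
  vanishing in \<open>R/I\<close> instead of a kernel, gives exactness the same form in all places and saves a
  separate start of the inductions below.\<close>

definition syz :: "('n::finite, 'k::field) mpoly set \<Rightarrow> ('n, 'k) free_complex \<Rightarrow> nat \<Rightarrow> (nat \<Rightarrow>\<^sub>0 ('n, 'k) mpoly) set" where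
  "syz I F i = {v \<in> free_module (basis F i).
     case i of 0 \<Rightarrow> aug_map F v \<in> I | Suc i' \<Rightarrow> diff_map F i' v = 0}"

definition graded_map :: "(nat \<Rightarrow> int) \<Rightarrow> nat set \<Rightarrow> (nat \<Rightarrow> int) \<Rightarrow> nat set \<Rightarrow>
    (nat \<Rightarrow> (nat \<Rightarrow>\<^sub>0 ('n::finite, 'k::field) mpoly)) \<Rightarrow> bool" where
  "graded_map \<delta> B \<delta>' B' \<phi> \<longleftrightarrow> (\<forall>b\<in>B. \<phi> b \<in> free_module B' \<and> form_vec \<delta>' (\<delta> b) (\<phi> b))"

lemma graded_map_lin_ext:
  assumes "graded_map \<delta> B \<delta>' B' \<phi>" "v \<in> free_module B"
  shows "lin_ext \<phi> v \<in> free_module B'" "form_vec \<delta> d v \<Longrightarrow> form_vec \<delta>' d (lin_ext \<phi> v)"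
    "hcomp_vec \<delta>' d (lin_ext \<phi> v) = lin_ext \<phi> (hcomp_vec \<delta> d v)"
  using assms unfolding graded_map_def
  by (auto intro!: free_module_lin_ext form_vec_lin_ext hcomp_vec_lin_ext)

lemma graded_map_compose:
  assumes "graded_map \<delta> B \<delta>' B' \<phi>" "graded_map \<delta>' B' \<delta>'' B'' \<chi>"
  shows "graded_map \<delta> B \<delta>'' B'' (\<lambda>b. lin_ext \<chi> (\<phi> b))"
  using assms(1) graded_map_lin_ext[OF assms(2)] by (auto simp: graded_map_def)

lemma graded_map_diff:
  "graded_map \<delta> B \<delta>' B' \<phi> \<Longrightarrow> graded_map \<delta> B \<delta>' B' \<chi> \<Longrightarrow> graded_map \<delta> B \<delta>' B' (\<lambda>b. \<phi> b - \<chi> b)"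
  by (auto simp: graded_map_def form_vec_diff)

lemma graded_map_id: "graded_map \<delta> B \<delta> B (\<lambda>b. Poly_Mapping.single b 1)"
  by (auto simp: graded_map_def form_vec_single)

lemma lookup_aug_map:
  assumes "finite A" "Poly_Mapping.keys v \<subseteq> A"
  shows "aug_map F v = (\<Sum>b\<in>A. Poly_Mapping.lookup v b * aug F b)"
  unfolding aug_map_def by (rule sum.mono_neutral_left) (use assms in \<open>auto simp: in_keys_iff\<close>)

lemma aug_map_lin_ext_1:
  "Poly_Mapping.lookup (lin_ext (\<lambda>b. Poly_Mapping.single (0::nat) (aug F b)) v) 0 = aug_map F v"
  by (simp add: aug_map_def lookup_lin_ext[of "Poly_Mapping.keys v"])

lemma aug_map_add: "aug_map F (v + w) = aug_map F v + aug_map F w"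
  and aug_map_diff: "aug_map F (v - w) = aug_map F v - aug_map F w"
  and aug_map_zero [simp]: "aug_map F 0 = 0"
  by (simp_all add: aug_map_lin_ext_1[symmetric] lin_ext_add lin_ext_diff lookup_add lookup_minus)

lemma aug_map_smult: "aug_map F (smult_vec a v) = a * aug_map F v"
  by (simp add: aug_map_lin_ext_1[symmetric] lin_ext_smult)

lemma aug_map_lin_ext:
  fixes v :: "nat \<Rightarrow>\<^sub>0 ('n::finite, 'k::field) mpoly"
  shows "aug_map F (lin_ext \<phi> v) = (\<Sum>b\<in>Poly_Mapping.keys v. Poly_Mapping.lookup v b * aug_map F (\<phi> b))"
proof -
  have "aug_map F (sum f S) = (\<Sum>s\<in>S. aug_map F (f s))" for f and S :: "nat set"
    by (induction S rule: infinite_finite_induct) (auto simp: aug_map_add)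
  then show ?thesis by (simp add: lin_ext_def aug_map_smult)
qed

lemma aug_map_hcomp:
  assumes "v \<in> free_module (basis F 0)" "\<And>b. b \<in> basis F 0 \<Longrightarrow> form (gdeg F 0 b) (aug F b)"
  shows "hcomp d (aug_map F v) = aug_map F (hcomp_vec (gdeg F 0) d v)"
proof -
  have "Poly_Mapping.keys (hcomp_vec (gdeg F 0) d v) \<subseteq> Poly_Mapping.keys v"
    by (auto simp: hcomp_vec_def keys_mapp_subset[THEN subsetD])
  moreover have "hcomp d (Poly_Mapping.lookup v b * aug F b) = hcomp (d - gdeg F 0 b) (Poly_Mapping.lookup v b) * aug F b"
    if "b \<in> Poly_Mapping.keys v" for b
    using assms that by (intro hcomp_mult_form) (auto simp: free_module_def)
  ultimately show ?thesis
    by (simp add: lookup_aug_map[of "Poly_Mapping.keys v"] hcomp_sum lookup_hcomp_vec)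
qed

lemma diff_map_diff: "diff_map F i (v - w) = diff_map F i v - diff_map F i w"
  and diff_map_single: "diff_map F i (Poly_Mapping.single b 1) = diff F i b"
  and diff_map_lin_ext: "diff_map F i (lin_ext \<phi> u) = lin_ext (\<lambda>b. diff_map F i (\<phi> b)) u"
  by (simp_all add: diff_map_def lin_ext_diff lin_ext_lin_ext)

lemma graded_free_resolution_alt:
  "graded_free_resolution I F \<longleftrightarrow>
     (\<forall>b\<in>basis F 0. form (gdeg F 0 b) (aug F b)) \<and>
     (\<forall>i. graded_map (gdeg F (Suc i)) (basis F (Suc i)) (gdeg F i) (basis F i) (diff F i)) \<and>
     (\<forall>f. \<exists>v\<in>free_module (basis F 0). f - aug_map F v \<in> I) \<and>
     (\<forall>i. syz I F i = diff_map F i ` free_module (basis F (Suc i)))"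
proof -
  have "(\<forall>i. syz I F i = diff_map F i ` free_module (basis F (Suc i))) \<longleftrightarrow>
     syz I F 0 = diff_map F 0 ` free_module (basis F (Suc 0)) \<and>
     (\<forall>i. syz I F (Suc i) = diff_map F (Suc i) ` free_module (basis F (Suc (Suc i))))"
    by (metis not0_implies_Suc)
  then show ?thesis
    by (simp add: graded_free_resolution_def graded_map_def syz_def)
qed

context
  fixes I :: "('n::finite, 'k::field) mpoly set" and G :: "('n, 'k) free_complex"
  assumes G: "graded_free_resolution I G"
begin

lemma resolution_aug: "b \<in> basis G 0 \<Longrightarrow> form (gdeg G 0 b) (aug G b)"
  and resolution_diff: "graded_map (gdeg G (Suc i)) (basis G (Suc i)) (gdeg G i) (basis G i) (diff G i)"
  and resolution_surj: "\<exists>v\<in>free_module (basis G 0). f - aug_map G v \<in> I"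
  and resolution_exact: "syz I G i = diff_map G i ` free_module (basis G (Suc i))"
  using G by (auto simp: graded_free_resolution_alt)

lemma diff_syz: "b \<in> basis G (Suc i) \<Longrightarrow> diff G i b \<in> syz I G i"
  unfolding resolution_exact by (rule image_eqI[of _ _ "Poly_Mapping.single b 1"]) (auto simp: diff_map_single)

text \<open>Since the differential is homogeneous, the component of degree \<open>d\<close> of any preimage is again a
  preimage.\<close>

lemma homogeneous_lift:
  assumes "y \<in> syz I G i" "form_vec (gdeg G i) d y"
  obtains x where "x \<in> free_module (basis G (Suc i))" "form_vec (gdeg G (Suc i)) d x" "diff_map G i x = y"
proof -
  from assms(1) obtain u where u: "u \<in> free_module (basis G (Suc i))" "y = diff_map G i u"
    unfolding resolution_exact by auto
  let ?x = "hcomp_vec (gdeg G (Suc i)) d u"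
  have "diff_map G i ?x = hcomp_vec (gdeg G i) d y"
    unfolding u(2) diff_map_def
    by (rule graded_map_lin_ext(3)[symmetric, OF resolution_diff u(1)])
  also have "\<dots> = y" using assms(2) by (simp add: form_vec_iff_hcomp)
  finally show thesis
    using that[of ?x] u(1) by (simp add: form_vec_hcomp hcomp_vec_free_module)
qed

lemma homogeneous_lift_map:
  assumes "\<And>b. b \<in> B \<Longrightarrow> y b \<in> syz I G i" "graded_map \<delta> B (gdeg G i) (basis G i) y"
  obtains x where "graded_map \<delta> B (gdeg G (Suc i)) (basis G (Suc i)) x" "\<And>b. b \<in> B \<Longrightarrow> diff_map G i (x b) = y b"
proof -
  have "\<forall>b\<in>B. \<exists>x. x \<in> free_module (basis G (Suc i)) \<and> form_vec (gdeg G (Suc i)) (\<delta> b) x \<and> diff_map G i x = y b"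
    using homogeneous_lift assms unfolding graded_map_def by metis
  then obtain x where "\<forall>b\<in>B. x b \<in> free_module (basis G (Suc i)) \<and> form_vec (gdeg G (Suc i)) (\<delta> b) (x b) \<and> diff_map G i (x b) = y b"
    by metis
  then show thesis using that[of x] by (auto simp: graded_map_def)
qed

lemma homogeneous_lift_aug:
  assumes "homogeneous_ideal I" "form d f"
  obtains x where "x \<in> free_module (basis G 0)" "form_vec (gdeg G 0) d x" "f - aug_map G x \<in> I"
proof -
  from resolution_surj[of f] obtain u where u: "u \<in> free_module (basis G 0)" "f - aug_map G u \<in> I" by auto
  let ?x = "hcomp_vec (gdeg G 0) d u"
  have "f - aug_map G ?x = hcomp d (f - aug_map G u)"
    using assms(2) by (simp add: hcomp_diff aug_map_hcomp[OF u(1) resolution_aug] form_iff_hcomp)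
  also have "\<dots> \<in> I" using assms(1) u(2) by (simp add: homogeneous_ideal_iff)
  finally show thesis
    using that[of ?x] u(1) by (simp add: form_vec_hcomp hcomp_vec_free_module)
qed

end

section \<open>Comparison of resolutions\<close>

definition chain_map :: "('n::finite, 'k::field) mpoly set \<Rightarrow> ('n, 'k) free_complex \<Rightarrow> ('n, 'k) free_complex \<Rightarrow>
    (nat \<Rightarrow> nat \<Rightarrow> (nat \<Rightarrow>\<^sub>0 ('n, 'k) mpoly)) \<Rightarrow> bool" where
  "chain_map I F G \<phi> \<longleftrightarrow>
     (\<forall>i. graded_map (gdeg F i) (basis F i) (gdeg G i) (basis G i) (\<phi> i)) \<and>
     (\<forall>v\<in>free_module (basis F 0). aug_map F v - aug_map G (lin_ext (\<phi> 0) v) \<in> I) \<and>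
     (\<forall>i. \<forall>v\<in>free_module (basis F (Suc i)).
        diff_map G i (lin_ext (\<phi> (Suc i)) v) = lin_ext (\<phi> i) (diff_map F i v))"

text \<open>The identity of \<open>R/I\<close> is lifted to \<open>F\<^sub>0\<close>, \<open>F\<^sub>1\<close>, and so on. A map that is already built takes syzygies
  to syzygies, so by exactness of \<open>G\<close> the images of the next basis vectors can be chosen.\<close>

lemma chain_map_exists:
  assumes I: "homogeneous_ideal I" and F: "graded_free_resolution I F" and G: "graded_free_resolution I G"
  obtains \<phi> where "chain_map I F G \<phi>"
proof -
  have id: "is_ideal I" using I by (simp add: homogeneous_ideal_iff)
  define P where "P i \<phi> \<longleftrightarrow> graded_map (gdeg F i) (basis F i) (gdeg G i) (basis G i) \<phi> \<and>
    (\<forall>v\<in>syz I F i. lin_ext \<phi> v \<in> syz I G i) \<and>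
    (i = 0 \<longrightarrow> (\<forall>v\<in>free_module (basis F 0). aug_map F v - aug_map G (lin_ext \<phi> v) \<in> I))" for i \<phi>
  define Q where "Q i \<phi> \<phi>' \<longleftrightarrow> (\<forall>v\<in>free_module (basis F (Suc i)). diff_map G i (lin_ext \<phi>' v) = lin_ext \<phi> (diff_map F i v))" for i \<phi> \<phi>'
  have base: "\<exists>\<phi>. P 0 \<phi>"
  proof -
    have "\<forall>b\<in>basis F 0. \<exists>x. x \<in> free_module (basis G 0) \<and> form_vec (gdeg G 0) (gdeg F 0 b) x \<and> aug F b - aug_map G x \<in> I"
      using homogeneous_lift_aug[OF G I] resolution_aug[OF F] by metis
    then obtain \<phi> where \<phi>: "\<And>b. b \<in> basis F 0 \<Longrightarrow>
        \<phi> b \<in> free_module (basis G 0) \<and> form_vec (gdeg G 0) (gdeg F 0 b) (\<phi> b) \<and> aug F b - aug_map G (\<phi> b) \<in> I"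
      by metis
    have g: "graded_map (gdeg F 0) (basis F 0) (gdeg G 0) (basis G 0) \<phi>"
      using \<phi> by (simp add: graded_map_def)
    have aug: "aug_map F v - aug_map G (lin_ext \<phi> v) \<in> I" if v: "v \<in> free_module (basis F 0)" for v
    proof -
      have "aug_map F v - aug_map G (lin_ext \<phi> v) =
          (\<Sum>b\<in>Poly_Mapping.keys v. Poly_Mapping.lookup v b * (aug F b - aug_map G (\<phi> b)))"
        by (simp add: aug_map_def[of F v] aug_map_lin_ext algebra_simps sum_subtractf)
      also have "\<dots> \<in> I"
        using \<phi> v id by (intro ideal_sum) (auto simp: is_ideal_def free_module_def)
      finally show ?thesis .
    qed
    have "lin_ext \<phi> v \<in> syz I G 0" if "v \<in> syz I F 0" for v
    proof -
      have v: "v \<in> free_module (basis F 0)" "aug_map F v \<in> I" using that by (auto simp: syz_def)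
      show ?thesis
        using ideal_diff[OF id v(2) aug[OF v(1)]] graded_map_lin_ext(1)[OF g v(1)] by (simp add: syz_def)
    qed
    then show ?thesis using g aug by (auto simp: P_def)
  qed
  have step: "\<exists>\<phi>'. P (Suc i) \<phi>' \<and> Q i \<phi> \<phi>'" if "P i \<phi>" for i \<phi>
  proof -
    from that have g: "graded_map (gdeg F i) (basis F i) (gdeg G i) (basis G i) \<phi>"
      and s: "\<And>v. v \<in> syz I F i \<Longrightarrow> lin_ext \<phi> v \<in> syz I G i" by (auto simp: P_def)
    have "graded_map (gdeg F (Suc i)) (basis F (Suc i)) (gdeg G i) (basis G i) (\<lambda>b. lin_ext \<phi> (diff F i b))"
      by (rule graded_map_compose[OF resolution_diff[OF F] g])
    then obtain \<phi>' where \<phi>': "graded_map (gdeg F (Suc i)) (basis F (Suc i)) (gdeg G (Suc i)) (basis G (Suc i)) \<phi>'"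
      "\<And>b. b \<in> basis F (Suc i) \<Longrightarrow> diff_map G i (\<phi>' b) = lin_ext \<phi> (diff F i b)"
      using homogeneous_lift_map[OF G, of "basis F (Suc i)" "\<lambda>b. lin_ext \<phi> (diff F i b)"] s[OF diff_syz[OF F]] by blast
    have Q: "diff_map G i (lin_ext \<phi>' v) = lin_ext \<phi> (diff_map F i v)" if "v \<in> free_module (basis F (Suc i))" for v
      unfolding diff_map_lin_ext unfolding diff_map_def[of F] lin_ext_lin_ext
      by (rule lin_ext_cong[OF that]) (rule \<phi>'(2))
    have "lin_ext \<phi>' v \<in> syz I G (Suc i)" if "v \<in> syz I F (Suc i)" for v
      using that Q[of v] graded_map_lin_ext(1)[OF \<phi>'(1), of v] by (auto simp: syz_def)
    then show ?thesis using \<phi>' Q by (auto simp: P_def Q_def)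
  qed
  obtain \<phi> where "\<And>i. P i (\<phi> i)" "\<And>i. Q i (\<phi> i) (\<phi> (Suc i))"
    using dependent_nat_choice[of P Q, OF base step] by blast
  then have "chain_map I F G \<phi>" unfolding chain_map_def P_def Q_def by blast
  then show thesis by (rule that)
qed

text \<open>A chain endomorphism \<open>h\<close> that induces zero on \<open>R/I\<close> satisfies \<open>h = d s + s d\<close> for some \<open>s\<close>.\<close>

lemma null_homotopy:
  assumes G: "graded_free_resolution I G"
    and gr: "\<And>i. graded_map (gdeg G i) (basis G i) (gdeg G i) (basis G i) (h i)"
    and aug: "\<And>v. v \<in> free_module (basis G 0) \<Longrightarrow> aug_map G (lin_ext (h 0) v) \<in> I"
    and comm: "\<And>i v. v \<in> free_module (basis G (Suc i)) \<Longrightarrow>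
      diff_map G i (lin_ext (h (Suc i)) v) = lin_ext (h i) (diff_map G i v)"
  obtains s where "\<And>i. graded_map (gdeg G i) (basis G i) (gdeg G (Suc i)) (basis G (Suc i)) (s i)"
    "\<And>v. v \<in> free_module (basis G 0) \<Longrightarrow> diff_map G 0 (lin_ext (s 0) v) = lin_ext (h 0) v"
    "\<And>i v. v \<in> free_module (basis G (Suc i)) \<Longrightarrow>
      diff_map G (Suc i) (lin_ext (s (Suc i)) v) = lin_ext (h (Suc i)) v - lin_ext (s i) (diff_map G i v)"
proof -
  \<comment> \<open>Given \<open>s\<close> in place \<open>i\<close>, the next \<open>s\<close> has to lift \<open>T = h - s d\<close> along \<open>d\<close>. This is possible since
    \<open>d T = h d - (d s) d\<close> and \<open>d s = h - s' d\<close>, where \<open>s'\<close> is the previous map and \<open>d d = 0\<close>.\<close>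
  define T where "T i s b = h (Suc i) b - lin_ext s (diff G i b)" for i s b
  have T_fun: "T i s = (\<lambda>b. h (Suc i) b - lin_ext s (diff G i b))" for i s by (rule ext) (rule T_def)
  define P where "P i s \<longleftrightarrow> graded_map (gdeg G i) (basis G i) (gdeg G (Suc i)) (basis G (Suc i)) s \<and>
    (\<forall>b\<in>basis G (Suc i). T i s b \<in> syz I G (Suc i)) \<and>
    (i = 0 \<longrightarrow> (\<forall>b\<in>basis G 0. diff_map G 0 (s b) = h 0 b))" for i s
  define Q where "Q i s s' \<longleftrightarrow> (\<forall>b\<in>basis G (Suc i). diff_map G (Suc i) (s' b) = T i s b)" for i s s'
  have T_graded: "graded_map (gdeg G (Suc i)) (basis G (Suc i)) (gdeg G (Suc i)) (basis G (Suc i)) (T i s)"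
    if "graded_map (gdeg G i) (basis G i) (gdeg G (Suc i)) (basis G (Suc i)) s" for i s
    unfolding T_def by (intro graded_map_diff gr graded_map_compose[OF resolution_diff[OF G]] that)
  have h_comm: "diff_map G i (h (Suc i) b) = lin_ext (h i) (diff G i b)" if "b \<in> basis G (Suc i)" for i b
    using comm[of "Poly_Mapping.single b 1" i] that by (simp add: diff_map_single)
  have base: "\<exists>s. P 0 s"
  proof -
    have "h 0 b \<in> syz I G 0" if "b \<in> basis G 0" for b
      using aug[of "Poly_Mapping.single b 1"] that gr[of 0] by (simp add: syz_def graded_map_def)
    then obtain s where s: "graded_map (gdeg G 0) (basis G 0) (gdeg G (Suc 0)) (basis G (Suc 0)) s"
      "\<And>b. b \<in> basis G 0 \<Longrightarrow> diff_map G 0 (s b) = h 0 b"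
      using homogeneous_lift_map[OF G _ gr[of 0]] by blast
    have "T 0 s b \<in> syz I G (Suc 0)" if b: "b \<in> basis G (Suc 0)" for b
    proof -
      have "diff G 0 b \<in> free_module (basis G 0)" using resolution_diff[OF G, of 0] b by (auto simp: graded_map_def)
      then have "lin_ext (\<lambda>c. diff_map G 0 (s c)) (diff G 0 b) = lin_ext (h 0) (diff G 0 b)"
        by (rule lin_ext_cong) (rule s(2))
      then have "diff_map G 0 (T 0 s b) = 0"
        by (simp add: T_def diff_map_diff h_comm[OF b] diff_map_lin_ext)
      then show ?thesis using T_graded[OF s(1)] b by (simp add: syz_def graded_map_def)
    qed
    then show ?thesis using s by (auto simp: P_def)
  qed
  have step: "\<exists>s'. P (Suc i) s' \<and> Q i s s'" if "P i s" for i s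
  proof -
    from that have g: "graded_map (gdeg G i) (basis G i) (gdeg G (Suc i)) (basis G (Suc i)) s"
      and T: "\<And>b. b \<in> basis G (Suc i) \<Longrightarrow> T i s b \<in> syz I G (Suc i)" by (auto simp: P_def)
    obtain s' where s': "graded_map (gdeg G (Suc i)) (basis G (Suc i)) (gdeg G (Suc (Suc i))) (basis G (Suc (Suc i))) s'"
      "\<And>b. b \<in> basis G (Suc i) \<Longrightarrow> diff_map G (Suc i) (s' b) = T i s b"
      using homogeneous_lift_map[OF G T T_graded[OF g]] by blast
    have "T (Suc i) s' b \<in> syz I G (Suc (Suc i))" if b: "b \<in> basis G (Suc (Suc i))" for b
    proof -
      let ?u = "diff G (Suc i) b"
      have u: "?u \<in> free_module (basis G (Suc i))" "diff_map G i ?u = 0"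
        using diff_syz[OF G b] by (auto simp: syz_def)
      have "lin_ext (\<lambda>c. diff_map G (Suc i) (s' c)) ?u = lin_ext (T i s) ?u"
        using u(1) by (rule lin_ext_cong) (rule s'(2))
      also have "\<dots> = lin_ext (h (Suc i)) ?u - lin_ext s (diff_map G i ?u)"
        by (simp add: T_fun lin_ext_map_diff diff_map_def lin_ext_lin_ext)
      finally have "diff_map G (Suc i) (T (Suc i) s' b) = 0"
        by (simp add: T_def diff_map_diff h_comm[OF b] diff_map_lin_ext u(2))
      then show ?thesis using T_graded[OF s'(1)] b by (simp add: syz_def graded_map_def)
    qed
    then show ?thesis using s' by (auto simp: P_def Q_def)
  qed
  obtain s where s: "\<And>i. P i (s i)" "\<And>i. Q i (s i) (s (Suc i))"
    using dependent_nat_choice[of P Q, OF base step] by blast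
  show thesis
  proof (rule that[of s])
    show "graded_map (gdeg G i) (basis G i) (gdeg G (Suc i)) (basis G (Suc i)) (s i)" for i
      using s(1) by (simp add: P_def)
    show "diff_map G 0 (lin_ext (s 0) v) = lin_ext (h 0) v" if "v \<in> free_module (basis G 0)" for v
      unfolding diff_map_lin_ext using s(1)[of 0] by (intro lin_ext_cong[OF that]) (simp add: P_def)
    show "diff_map G (Suc i) (lin_ext (s (Suc i)) v) = lin_ext (h (Suc i)) v - lin_ext (s i) (diff_map G i v)"
      if "v \<in> free_module (basis G (Suc i))" for i v
    proof -
      have "diff_map G (Suc i) (lin_ext (s (Suc i)) v) = lin_ext (T i (s i)) v"
        unfolding diff_map_lin_ext using s(2)[of i] by (intro lin_ext_cong[OF that]) (simp add: Q_def)
      then show ?thesis by (simp add: T_fun lin_ext_map_diff diff_map_def lin_ext_lin_ext)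
    qed
  qed
qed

section \<open>Independence of Tor from the resolution\<close>

abbreviation const_term :: "('n::finite, 'k::field) mpoly \<Rightarrow> 'k" where
  "const_term f \<equiv> Poly_Mapping.lookup f 0"

text \<open>A factor without constant term contributes only monomials of positive degree to a product.\<close>

lemma ring_hom_const_term: "ring_hom (const_term :: ('n::finite, 'k::field) mpoly \<Rightarrow> 'k)"
  unfolding ring_hom_def
proof (intro conjI allI)
  fix f g :: "('n, 'k) mpoly"
  show "const_term (f + g) = const_term f + const_term g" by (rule lookup_add)
  have split: "h = hcomp 0 h + (h - hcomp 0 h)" for h :: "('n, 'k) mpoly" by simp
  have mdeg0: "mdeg t = 0 \<longleftrightarrow> t = 0" for t :: "'n \<Rightarrow>\<^sub>0 nat"
    by (auto simp: mdeg_def poly_mapping_eq_iff fun_eq_iff)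
  have h0: "hcomp 0 h = Poly_Mapping.single 0 (const_term h)" for h :: "('n, 'k) mpoly"
    by (rule poly_mapping_eqI) (auto simp: lookup_hcomp lookup_single when_def mdeg0)
  have high: "const_term ((h - hcomp 0 h) * h') = 0" for h h' :: "('n, 'k) mpoly"
  proof (rule ccontr)
    assume "const_term ((h - hcomp 0 h) * h') \<noteq> 0"
    then have "0 \<in> Poly_Mapping.keys ((h - hcomp 0 h) * h')" by (simp add: in_keys_iff)
    then obtain s t where st: "s \<in> Poly_Mapping.keys (h - hcomp 0 h)" "0 = s + t"
      using keys_mult[of "h - hcomp 0 h" h'] by blast
    then have "mdeg s = 0" using mdeg_add[of s t] by (metis add_is_0 mdeg0)
    then show False using st(1) by (simp add: in_keys_iff lookup_minus lookup_hcomp)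
  qed
  have "const_term (f * g) = const_term (hcomp 0 f * g)"
    by (subst split[of f]) (simp only: distrib_right lookup_add high add_0_right)
  also have "\<dots> = const_term (hcomp 0 f * hcomp 0 g) + const_term ((g - hcomp 0 g) * hcomp 0 f)"
    by (subst split[of g]) (simp only: distrib_left lookup_add mult.commute)
  also have "\<dots> = const_term f * const_term g"
    by (simp only: high add_0_right) (simp add: h0 mult_single)
  finally show "const_term (f * g) = const_term f * const_term g" .
qed simp

abbreviation bar :: "('b \<Rightarrow>\<^sub>0 ('n::finite, 'k::field) mpoly) \<Rightarrow> ('b \<Rightarrow>\<^sub>0 'k)" where
  "bar v \<equiv> Poly_Mapping.map const_term v"

lemmas bar_lin_ext = map_lin_ext[OF ring_hom_const_term]

text \<open>An entry of the matrix between generators of different degrees is a form of nonzero degree and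
  has no constant term, so that the reduced matrix preserves degrees.\<close>

lemma bar_graded_map:
  assumes "graded_map \<delta> B \<delta>' B' \<phi>" "v \<in> free_module {b\<in>B. \<delta> b = j}"
  shows "lin_ext (\<lambda>b. bar (\<phi> b)) v \<in> free_module {b\<in>B'. \<delta>' b = j}"
proof (rule free_module_lin_ext[OF assms(2)])
  fix b assume b: "b \<in> {b\<in>B. \<delta> b = j}"
  have "const_term (Poly_Mapping.lookup (\<phi> b) c) = 0" if "\<not> (c \<in> B' \<and> \<delta>' c = j)" for c
    using assms(1) b that form_lookup_0[of "j - \<delta>' c" "Poly_Mapping.lookup (\<phi> b) c"]
    by (cases "c \<in> B'") (auto simp: graded_map_def form_vec_def free_module_lookup)
  then show "bar (\<phi> b) \<in> free_module {b\<in>B'. \<delta>' b = j}"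
    by (simp add: free_module_lookup lookup_map)
qed

lemma tensor_part_free_module: "v \<in> tensor_part F i j \<Longrightarrow> v \<in> free_module (basis F i)"
  by (auto simp: tensor_part_def free_module_def)

lemma tensor_diff_add: "tensor_diff F i (v + w) = tensor_diff F i v + tensor_diff F i w"
  and tensor_diff_smult: "tensor_diff F i (smult_vec a v) = smult_vec a (tensor_diff F i v)"
  and tensor_diff_zero: "tensor_diff F i 0 = 0"
  by (simp_all add: tensor_diff_def lin_ext_add lin_ext_smult)

text \<open>A relation between matrices over the polynomial ring is inherited by the matrices of constant
  terms. Chain maps and homotopies are transferred to the tensored complexes in this way.\<close>

lemma bar_matrix:
  assumes "v \<in> free_module B" "\<And>b. b \<in> B \<Longrightarrow> lin_ext \<phi> (\<chi> b) = \<xi> b"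
  shows "lin_ext (\<lambda>c. bar (\<phi> c)) (lin_ext (\<lambda>b. bar (\<chi> b)) v) = lin_ext (\<lambda>b. bar (\<xi> b)) v"
  unfolding lin_ext_lin_ext
  by (rule lin_ext_cong[OF assms(1)]) (simp add: assms(2)[symmetric] bar_lin_ext)

definition vec_subspace :: "('b \<Rightarrow>\<^sub>0 'k::field) set \<Rightarrow> bool" where
  "vec_subspace V \<longleftrightarrow> 0 \<in> V \<and> (\<forall>v\<in>V. \<forall>w\<in>V. v + w \<in> V) \<and> (\<forall>a. \<forall>v\<in>V. smult_vec a v \<in> V)"

lemma vec_subspace_add: "vec_subspace V \<Longrightarrow> v \<in> V \<Longrightarrow> w \<in> V \<Longrightarrow> v + w \<in> V"
  and vec_subspace_smult: "vec_subspace V \<Longrightarrow> v \<in> V \<Longrightarrow> smult_vec a v \<in> V"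
  by (auto simp: vec_subspace_def)

lemma subspace_tor_cycles: "vec_subspace (tor_cycles F i j)"
  by (cases i) (auto simp: vec_subspace_def tor_cycles_def tensor_part_def tensor_diff_add tensor_diff_smult tensor_diff_zero
      smult_vec_zero free_module_smult free_module_add)

lemma subspace_tor_boundaries: "vec_subspace (tor_boundaries F i j)"
  unfolding vec_subspace_def tor_boundaries_def tensor_part_def
proof (intro conjI ballI allI)
  show "0 \<in> tensor_diff F i ` free_module {b \<in> basis F (Suc i). gdeg F (Suc i) b = j}"
    by (rule image_eqI[of _ _ 0]) (simp_all add: tensor_diff_zero)
qed (auto simp: tensor_diff_add[symmetric] tensor_diff_smult[symmetric])

lemma boundaries_cycles:
  fixes I :: "('n::finite, 'k::field) mpoly set"
  assumes F: "graded_free_resolution I F"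
  shows "tor_boundaries F i j \<subseteq> tor_cycles F i j"
proof
  fix w assume "w \<in> tor_boundaries F i j"
  then obtain v where v: "v \<in> tensor_part F (Suc i) j" "w = tensor_diff F i v"
    by (auto simp: tor_boundaries_def)
  have "w \<in> tensor_part F i j"
    unfolding v(2) tensor_diff_def tensor_part_def
    by (rule bar_graded_map[OF resolution_diff[OF F]]) (use v(1) in \<open>simp add: tensor_part_def\<close>)
  moreover have "tensor_diff F i' w = 0" if i: "i = Suc i'" for i'
  proof -
    have d: "lin_ext (diff F i') (diff F i b) = 0" if "b \<in> basis F (Suc i)" for b
      using diff_syz[OF F that] i by (simp add: syz_def diff_map_def)
    have "lin_ext (\<lambda>c. bar (diff F i' c)) (lin_ext (\<lambda>b. bar (diff F i b)) v) =
        lin_ext (\<lambda>b. bar (0 :: nat \<Rightarrow>\<^sub>0 ('n, 'k) mpoly)) v"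
      by (rule bar_matrix[where \<xi>="\<lambda>_. 0", OF tensor_part_free_module[OF v(1)]]) (rule d)
    also have "lin_ext (\<lambda>b. bar (0 :: nat \<Rightarrow>\<^sub>0 ('n, 'k) mpoly)) v = 0"
      by (rule poly_mapping_eqI) (simp add: lookup_lin_ext[of "Poly_Mapping.keys v"] lookup_map)
    finally show ?thesis by (simp add: v(2) tensor_diff_def)
  qed
  ultimately show "w \<in> tor_cycles F i j" by (cases i) (auto simp: tor_cycles_def)
qed

context
  fixes I :: "('n::finite, 'k::field) mpoly set" and F G and \<phi>
  assumes \<phi>: "chain_map I F G \<phi>"
begin

lemma chain_map_graded: "graded_map (gdeg F i) (basis F i) (gdeg G i) (basis G i) (\<phi> i)"
  and chain_map_aug: "v \<in> free_module (basis F 0) \<Longrightarrow> aug_map F v - aug_map G (lin_ext (\<phi> 0) v) \<in> I"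
  and chain_map_comm: "v \<in> free_module (basis F (Suc i)) \<Longrightarrow>
        diff_map G i (lin_ext (\<phi> (Suc i)) v) = lin_ext (\<phi> i) (diff_map F i v)"
  using \<phi> unfolding chain_map_def by blast+

lemma tensor_chain_map:
  assumes "v \<in> free_module (basis F (Suc i))"
  shows "tensor_diff G i (lin_ext (\<lambda>b. bar (\<phi> (Suc i) b)) v) = lin_ext (\<lambda>b. bar (\<phi> i b)) (tensor_diff F i v)"
proof -
  have "lin_ext (diff G i) (\<phi> (Suc i) b) = lin_ext (\<phi> i) (diff F i b)" if "b \<in> basis F (Suc i)" for b
    using chain_map_comm[of "Poly_Mapping.single b 1" i] that by (simp add: diff_map_single diff_map_def)
  from bar_matrix[OF assms this]
  have "tensor_diff G i (lin_ext (\<lambda>b. bar (\<phi> (Suc i) b)) v) = lin_ext (\<lambda>b. bar (lin_ext (\<phi> i) (diff F i b))) v"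
    by (simp add: tensor_diff_def)
  also have "\<dots> = lin_ext (\<lambda>b. bar (\<phi> i b)) (tensor_diff F i v)"
    unfolding tensor_diff_def by (rule bar_matrix[OF assms, symmetric]) simp
  finally show ?thesis .
qed

lemma tensor_chain_map_part:
  "v \<in> tensor_part F i j \<Longrightarrow> lin_ext (\<lambda>b. bar (\<phi> i b)) v \<in> tensor_part G i j"
  unfolding tensor_part_def by (rule bar_graded_map[OF chain_map_graded])

lemma tensor_chain_map_cycles:
  assumes "v \<in> tor_cycles F i j"
  shows "lin_ext (\<lambda>b. bar (\<phi> i b)) v \<in> tor_cycles G i j"
proof (cases i)
  case 0
  then show ?thesis using assms tensor_chain_map_part[of v 0] by (simp add: tor_cycles_def)
next
  case (Suc i')
  then have v: "v \<in> tensor_part F (Suc i') j" "tensor_diff F i' v = 0"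
    using assms by (auto simp: tor_cycles_def)
  show ?thesis
    using tensor_chain_map_part[OF v(1)] tensor_chain_map[OF tensor_part_free_module[OF v(1)]] v(2) Suc
    by (simp add: tor_cycles_def)
qed

lemma tensor_chain_map_boundaries:
  assumes "v \<in> tor_boundaries F i j"
  shows "lin_ext (\<lambda>b. bar (\<phi> i b)) v \<in> tor_boundaries G i j"
proof -
  obtain u where u: "u \<in> tensor_part F (Suc i) j" "v = tensor_diff F i u"
    using assms by (auto simp: tor_boundaries_def)
  show ?thesis
    using tensor_chain_map_part[OF u(1)] tensor_chain_map[OF tensor_part_free_module[OF u(1)]]
    unfolding tor_boundaries_def u(2) by (intro image_eqI[of _ "tensor_diff G i"]) auto
qed

end

text \<open>With chain maps \<open>\<phi>\<close> from \<open>F\<close> to \<open>G\<close> and \<open>\<gamma>\<close> back, \<open>id - \<phi> \<gamma>\<close> is homotopic to zero, so that the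
  map \<open>L\<close> induced by \<open>\<phi>\<close> is surjective on homology. Because \<open>F\<close> and \<open>G\<close> can be exchanged, surjectivity
  suffices to transport both the vanishing and the finite dimension of Tor.\<close>

lemma tor_surjective:
  assumes I: "homogeneous_ideal I" and F: "graded_free_resolution I F" and G: "graded_free_resolution I G"
  obtains L where "\<And>a v. L (smult_vec a v) = smult_vec a (L v)" "\<And>v w. L (v + w) = L v + L w"
    "\<And>v. v \<in> tor_boundaries F i j \<Longrightarrow> L v \<in> tor_boundaries G i j"
    "\<And>v. v \<in> tor_cycles G i j \<Longrightarrow> \<exists>u\<in>tor_cycles F i j. v - L u \<in> tor_boundaries G i j"
proof -
  obtain \<phi> where \<phi>: "chain_map I F G \<phi>" by (rule chain_map_exists[OF I F G])
  obtain \<gamma> where \<gamma>: "chain_map I G F \<gamma>" by (rule chain_map_exists[OF I G F])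
  have id: "is_ideal I" using I by (simp add: homogeneous_ideal_iff)
  let ?L = "lin_ext (\<lambda>b. bar (\<phi> i b))" and ?M = "lin_ext (\<lambda>b. bar (\<gamma> i b))"
  define h where "h i = (\<lambda>b. Poly_Mapping.single b 1 - lin_ext (\<phi> i) (\<gamma> i b))" for i
  have h_lin: "lin_ext (h i) v = v - lin_ext (\<phi> i) (lin_ext (\<gamma> i) v)" for i v
    by (simp add: h_def lin_ext_map_diff lin_ext_lin_ext lin_ext_id)
  have gr: "graded_map (gdeg G i) (basis G i) (gdeg G i) (basis G i) (h i)" for i
    unfolding h_def
    by (intro graded_map_diff graded_map_id graded_map_compose[OF chain_map_graded[OF \<gamma>] chain_map_graded[OF \<phi>]])
  have \<gamma>_free: "lin_ext (\<gamma> i) v \<in> free_module (basis F i)" if "v \<in> free_module (basis G i)" for i v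
    using graded_map_lin_ext(1)[OF chain_map_graded[OF \<gamma>] that] .
  have aug: "aug_map G (lin_ext (h 0) v) \<in> I" if v: "v \<in> free_module (basis G 0)" for v
  proof -
    let ?u = "lin_ext (\<gamma> 0) v"
    have "aug_map G v - aug_map F ?u \<in> I" "aug_map F ?u - aug_map G (lin_ext (\<phi> 0) ?u) \<in> I"
      using chain_map_aug[OF \<gamma> v] chain_map_aug[OF \<phi> \<gamma>_free[OF v]] .
    then have "(aug_map G v - aug_map F ?u) + (aug_map F ?u - aug_map G (lin_ext (\<phi> 0) ?u)) \<in> I"
      using id unfolding is_ideal_def by blast
    then show ?thesis by (simp add: h_lin aug_map_diff)
  qed
  have comm: "diff_map G i (lin_ext (h (Suc i)) v) = lin_ext (h i) (diff_map G i v)"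
    if v: "v \<in> free_module (basis G (Suc i))" for i v
    by (simp add: h_lin diff_map_diff chain_map_comm[OF \<gamma> v] chain_map_comm[OF \<phi> \<gamma>_free[OF v]])
  obtain s where s: "\<And>i. graded_map (gdeg G i) (basis G i) (gdeg G (Suc i)) (basis G (Suc i)) (s i)"
    "\<And>v. v \<in> free_module (basis G 0) \<Longrightarrow> diff_map G 0 (lin_ext (s 0) v) = lin_ext (h 0) v"
    "\<And>i v. v \<in> free_module (basis G (Suc i)) \<Longrightarrow>
      diff_map G (Suc i) (lin_ext (s (Suc i)) v) = lin_ext (h (Suc i)) v - lin_ext (s i) (diff_map G i v)"
    using null_homotopy[OF G gr aug comm] by blast
  have bar_h: "lin_ext (\<lambda>b. bar (h i b)) v = v - ?L (?M v)" for v
  proof -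
    have "lin_ext (\<lambda>b. bar (h i b)) v = lin_ext (\<lambda>b. Poly_Mapping.single b 1 - bar (lin_ext (\<phi> i) (\<gamma> i b))) v"
      by (simp add: h_def map_minus[OF ring_hom_const_term])
    also have "\<dots> = v - lin_ext (\<lambda>b. bar (lin_ext (\<phi> i) (\<gamma> i b))) v"
      by (simp add: lin_ext_map_diff lin_ext_id)
    also have "lin_ext (\<lambda>b. bar (lin_ext (\<phi> i) (\<gamma> i b))) v = ?L (?M v)"
      by (rule bar_matrix[symmetric, of _ UNIV]) (simp_all add: free_module_def)
    finally show ?thesis .
  qed
  have "v - ?L (?M v) \<in> tor_boundaries G i j" if "v \<in> tor_cycles G i j" for v
  proof -
    have v: "v \<in> tensor_part G i j" using that by (auto simp: tor_cycles_def split: nat.splits)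
    let ?S = "lin_ext (\<lambda>b. bar (s i b)) v"
    have "?S \<in> tensor_part G (Suc i) j"
      unfolding tensor_part_def using bar_graded_map[OF s(1)] v by (simp add: tensor_part_def)
    moreover have "tensor_diff G i ?S = lin_ext (\<lambda>b. bar (h i b)) v"
    proof (cases i)
      case 0
      have "lin_ext (diff G 0) (s 0 b) = h 0 b" if "b \<in> basis G 0" for b
        using s(2)[of "Poly_Mapping.single b 1"] that by (simp add: diff_map_def)
      then show ?thesis
        unfolding tensor_diff_def using tensor_part_free_module[OF v] 0 by (intro bar_matrix) auto
    next
      case (Suc i')
      have eq: "lin_ext (diff G i) (s i b) = h i b - lin_ext (s i') (diff G i' b)" if "b \<in> basis G i" for b
        using s(3)[of "Poly_Mapping.single b 1" i'] that Suc by (simp add: diff_map_def)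
      have "tensor_diff G i ?S = lin_ext (\<lambda>b. bar (h i b - lin_ext (s i') (diff G i' b))) v"
        unfolding tensor_diff_def by (rule bar_matrix[OF tensor_part_free_module[OF v] eq])
      also have "\<dots> = lin_ext (\<lambda>b. bar (h i b)) v - lin_ext (\<lambda>b. bar (lin_ext (s i') (diff G i' b))) v"
        by (simp add: map_minus[OF ring_hom_const_term] lin_ext_map_diff)
      also have "lin_ext (\<lambda>b. bar (lin_ext (s i') (diff G i' b))) v = lin_ext (\<lambda>b. bar (s i' b)) (tensor_diff G i' v)"
        unfolding tensor_diff_def by (rule bar_matrix[OF tensor_part_free_module[OF v], symmetric]) simp
      also have "tensor_diff G i' v = 0" using that Suc by (simp add: tor_cycles_def)
      finally show ?thesis by simp
    qed
    ultimately show ?thesis unfolding tor_boundaries_def bar_h[symmetric] by (intro image_eqI[of _ "tensor_diff G i" ?S]) simp_all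
  qed
  then have surj: "\<exists>u\<in>tor_cycles F i j. v - ?L u \<in> tor_boundaries G i j" if "v \<in> tor_cycles G i j" for v
    using tensor_chain_map_cycles[OF \<gamma> that] that by blast
  show thesis
    by (rule that[of ?L, OF lin_ext_smult lin_ext_add tensor_chain_map_boundaries[OF \<phi>] surj])
qed

section \<open>Dimensions of quotient spaces\<close>

lemma vector_space_smult_vec: "vector_space (smult_vec :: 'k::field \<Rightarrow> ('b \<Rightarrow>\<^sub>0 'k) \<Rightarrow> _)"
  by unfold_locales (simp_all add: smult_vec_alg)

definition finite_mod :: "('b \<Rightarrow>\<^sub>0 'k::field) set \<Rightarrow> ('b \<Rightarrow>\<^sub>0 'k) set \<Rightarrow> bool" where
  "finite_mod V W \<longleftrightarrow> (\<exists>S. finite S \<and> (\<forall>v\<in>V. \<exists>u. v - (\<Sum>s\<in>S. smult_vec (u s) s) \<in> W))"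

text \<open>The projection onto a complement of \<open>W\<close> along \<open>W\<close>; its image is a model of the quotient by \<open>W\<close>.\<close>

lemma projection_exists:
  fixes W :: "('b \<Rightarrow>\<^sub>0 'k::field) set"
  assumes W: "vec_subspace W"
  obtains p where "Vector_Spaces.linear smult_vec smult_vec p" "\<And>w. w \<in> W \<Longrightarrow> p w = 0" "\<And>v. v - p v \<in> W"
proof -
  interpret vector_space "smult_vec :: 'k \<Rightarrow> ('b \<Rightarrow>\<^sub>0 'k) \<Rightarrow> _" by (rule vector_space_smult_vec)
  interpret vp: vector_space_pair "smult_vec :: 'k \<Rightarrow> ('b \<Rightarrow>\<^sub>0 'k) \<Rightarrow> _" "smult_vec :: 'k \<Rightarrow> ('b \<Rightarrow>\<^sub>0 'k) \<Rightarrow> _" ..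
  have sub: "module.subspace smult_vec W"
    using W by (auto simp: vec_subspace_def module.subspace_def[OF module_axioms])
  obtain C where C: "C \<subseteq> W" "independent C" "W \<subseteq> span C" by (rule maximal_independent_subset)
  define D where "D = extend_basis C"
  have D: "independent D" "C \<subseteq> D" "span D = UNIV"
    unfolding D_def using C independent_extend_basis extend_basis_superset span_extend_basis by auto
  define p where "p = vp.construct D (\<lambda>d. if d \<in> C then 0 else d)"
  have lin: "Vector_Spaces.linear smult_vec smult_vec p" unfolding p_def by (rule vp.linear_construct[OF D(1)])
  interpret p: Vector_Spaces.linear smult_vec smult_vec p by (rule lin)
  have pb: "p d = (if d \<in> C then 0 else d)" if "d \<in> D" for d
    unfolding p_def by (rule vp.construct_basis[OF D(1) that])
  have "p w = 0" if "w \<in> W" for w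
  proof -
    have "w \<in> span C" using C that by blast
    then show ?thesis
      by (rule span_induct) (use pb D(2) in \<open>auto simp: module.subspace_def[OF module_axioms] p.zero p.add p.scale\<close>)
  qed
  moreover have "v - p v \<in> W" for v
  proof -
    have "v \<in> span D" using D by simp
    then have "v - p v \<in> span C"
    proof (induction rule: span_induct_alt)
      case base
      then show ?case by (simp add: p.zero span_zero)
    next
      case (step c x y)
      have "x - p x \<in> span C" using pb[OF step(1)] by (auto simp: span_base span_zero)
      then have "smult_vec c (x - p x) + (y - p y) \<in> span C" using step by (intro span_add span_scale)
      then show ?case by (simp add: p.add p.scale scale_right_diff_distrib algebra_simps)
    qed
    then show ?thesis using span_minimal[OF C(1) sub] by auto
  qed
  ultimately show thesis using that lin by blast
qed

text \<open>The chosen quotient basis could be infinite, in which case its cardinality is \<open>0\<close>. If \<open>V\<close> is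
  finitely generated modulo \<open>W\<close>, every quotient basis is finite: the projection along \<open>W\<close> maps it
  injectively to an independent set in the span of finitely many vectors.\<close>

lemma quotient_dim_nonzero_iff:
  fixes V W :: "('b \<Rightarrow>\<^sub>0 'k::field) set"
  assumes V: "vec_subspace V" and W: "vec_subspace W" and WV: "W \<subseteq> V" and fin: "finite_mod V W"
  shows "quotient_dim V W \<noteq> 0 \<longleftrightarrow> \<not> V \<subseteq> W"
proof -
  interpret vector_space "smult_vec :: 'k \<Rightarrow> ('b \<Rightarrow>\<^sub>0 'k) \<Rightarrow> _" by (rule vector_space_smult_vec)
  obtain p where lin: "Vector_Spaces.linear smult_vec smult_vec p"
    and pW: "\<And>w. w \<in> W \<Longrightarrow> p w = 0" and pd: "\<And>v. v - p v \<in> W"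
    using projection_exists[OF W] by blast
  interpret p: Vector_Spaces.linear smult_vec smult_vec p by (rule lin)
  have W_iff: "w \<in> W \<longleftrightarrow> p w = 0" for w using pW pd[of w] by auto
  have pp: "p (p v) = p v" for v
    using pW[OF pd[of v]] by (simp add: p.diff)
  have p_comb: "p (\<Sum>b\<in>S. smult_vec (u b) b) = (\<Sum>b\<in>S. smult_vec (u b) (p b))" for S u
    by (simp add: p.sum p.scale)
  have "\<exists>B. quotient_basis V W B"
  proof -
    obtain B where B: "B \<subseteq> p ` V" "independent B" "p ` V \<subseteq> span B" by (rule maximal_independent_subset)
    have pB: "p b = b" if "b \<in> B" for b using B(1) that pp by auto
    have "p v \<in> V" if "v \<in> V" for v
    proof -
      have "v - p v \<in> V" using pd[of v] WV by (rule subsetD[rotated])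
      then have "v + smult_vec (- 1) (v - p v) \<in> V" using that V
        by (intro vec_subspace_add[OF V] vec_subspace_smult[OF V])
      moreover have "v + smult_vec (- 1) (v - p v) = p v"
        by (rule poly_mapping_eqI) (simp add: lookup_add lookup_minus)
      ultimately show ?thesis by simp
    qed
    then have "B \<subseteq> V" using B(1) by auto
    moreover have "\<forall>b\<in>S. u b = 0" if S: "finite S" "S \<subseteq> B" "(\<Sum>b\<in>S. smult_vec (u b) b) \<in> W" for S u
    proof -
      have "(\<Sum>b\<in>S. smult_vec (u b) b) = (\<Sum>b\<in>S. smult_vec (u b) (p b))"
        using S(2) pB by (intro sum.cong) auto
      also have "\<dots> = 0" using S(3) by (simp add: W_iff p_comb)
      finally show ?thesis using B(2) S(1,2) by (auto simp: independent_explicit_module)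
    qed
    moreover have "\<exists>S u. finite S \<and> S \<subseteq> B \<and> v - (\<Sum>b\<in>S. smult_vec (u b) b) \<in> W" if "v \<in> V" for v
    proof -
      have "p v \<in> span B" using that B(3) by auto
      then obtain S u where "finite S" "S \<subseteq> B" "p v = (\<Sum>b\<in>S. smult_vec (u b) b)"
        unfolding span_explicit by auto
      then show ?thesis using pd[of v] by metis
    qed
    ultimately have "quotient_basis V W B" unfolding quotient_basis_def by (intro conjI allI impI ballI) auto
    then show ?thesis ..
  qed
  define B where "B = (SOME B. quotient_basis V W B)"
  have qb: "quotient_basis V W B" unfolding B_def using \<open>\<exists>B. quotient_basis V W B\<close> by (rule someI_ex)
  have qbV: "B \<subseteq> V" using qb by (simp add: quotient_basis_def)
  have qbI: "u b = 0" if "finite S" "S \<subseteq> B" "(\<Sum>b\<in>S. smult_vec (u b) b) \<in> W" "b \<in> S" for S u b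
  proof -
    have "(\<forall>S u. finite S \<and> S \<subseteq> B \<and> (\<Sum>b\<in>S. smult_vec (u b) b) \<in> W \<longrightarrow> (\<forall>b\<in>S. u b = 0))"
      using qb unfolding quotient_basis_def by (elim conjE)
    from this[rule_format, of S u b] that show ?thesis by simp
  qed
  show ?thesis
  proof (cases "V \<subseteq> W")
    case True
    have "B = {}"
    proof (rule ccontr)
      assume "B \<noteq> {}"
      then obtain b where b: "b \<in> B" by blast
      then have "(\<Sum>b\<in>{b}. smult_vec ((\<lambda>_. 1) b) b) \<in> W"
        using True qbV by (auto simp: smult_vec_alg)
      from qbI[OF _ _ this] b show False by simp
    qed
    then show ?thesis using True by (simp add: quotient_dim_def B_def[symmetric])
  next
    case False
    then have ne: "B \<noteq> {}" using qb W by (auto simp: quotient_basis_def)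
    obtain S where S: "finite S" "\<And>v. v \<in> V \<Longrightarrow> \<exists>u. v - (\<Sum>s\<in>S. smult_vec (u s) s) \<in> W"
      using fin by (auto simp: finite_mod_def)
    have "independent (p ` B) \<and> inj_on p B"
    proof -
      have "inj_on p B"
      proof (rule inj_onI, rule ccontr)
        fix x y assume xy: "x \<in> B" "y \<in> B" "p x = p y" "x \<noteq> y"
        let ?u = "\<lambda>b. if b = x then 1 else - 1 :: 'k"
        have "(\<Sum>b\<in>{x,y}. smult_vec (?u b) b) \<in> W"
          using xy by (simp add: W_iff p.add p.scale smult_vec_alg p.diff p.neg)
        from qbI[OF _ _ this, of x] xy show False by simp
      qed
      moreover have "independent (p ` B)"
        unfolding independent_explicit_module
      proof (intro allI impI)
        fix T u b assume T: "finite T" "T \<subseteq> p ` B" "(\<Sum>b\<in>T. smult_vec (u b) b) = 0" "b \<in> T"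
        obtain T' where T': "T' \<subseteq> B" "T = p ` T'" using T(2) by (auto simp: subset_image_iff)
        have inj: "inj_on p T'" using \<open>inj_on p B\<close> T'(1) by (rule inj_on_subset)
        have "finite T'" using T(1) T'(2) inj by (simp add: finite_image_iff)
        have "p (\<Sum>b\<in>T'. smult_vec ((u \<circ> p) b) b) = 0"
          using T(3) unfolding p_comb T'(2) by (simp add: sum.reindex[OF inj])
        then have "(u \<circ> p) b' = 0" if "b' \<in> T'" for b'
          using that T'(1) \<open>finite T'\<close> by (intro qbI) (simp_all add: W_iff)
        then show "u b = 0" using T(4) T'(2) by auto
      qed
      ultimately show ?thesis by blast
    qed
    moreover have "p ` B \<subseteq> span (p ` S)"
    proof safe
      fix b assume "b \<in> B"
      then have "b \<in> V" using qbV by auto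
      then obtain u where "b - (\<Sum>s\<in>S. smult_vec (u s) s) \<in> W" using S(2) by blast
      then have "p b = (\<Sum>s\<in>S. smult_vec (u s) (p s))" by (simp add: W_iff p.diff p_comb)
      also have "\<dots> \<in> span (p ` S)" by (intro span_sum span_scale span_base) auto
      finally show "p b \<in> span (p ` S)" .
    qed
    ultimately have "finite (p ` B)" "inj_on p B" using independent_span_bound[of "p ` S" "p ` B"] S(1) by auto
    then have "finite B" by (simp add: finite_image_iff)
    then show ?thesis using ne False by (simp add: quotient_dim_def B_def[symmetric] card_eq_0_iff)
  qed
qed

section \<open>Existence of locally finite resolutions\<close>

lemma finite_mdeg_le: "finite {t :: 'n::finite \<Rightarrow>\<^sub>0 nat. mdeg t \<le> N}"
proof (rule finite_imageD)
  have "Poly_Mapping.lookup t x \<le> N" if "mdeg t \<le> N" for t :: "'n \<Rightarrow>\<^sub>0 nat" and x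
    using member_le_sum[of x UNIV "Poly_Mapping.lookup t"] that by (simp add: mdeg_def)
  then show "finite (Poly_Mapping.lookup ` {t :: 'n \<Rightarrow>\<^sub>0 nat. mdeg t \<le> N})"
    by (intro finite_subset[OF _ finite_set_of_finite_funs[of UNIV "{..N}"]]) auto
qed (auto intro!: inj_onI poly_mapping_eqI)

lemma ring_hom_Const: "ring_hom (Const :: 'k \<Rightarrow> ('n, 'k::field) mpoly)"
  by (simp add: ring_hom_def Const_def single_add mult_single)

lemma vector_space_scale_Const:
  "vector_space (\<lambda>(c::'k::field) v. smult_vec (Const c :: ('n, 'k) mpoly) (v :: 'b \<Rightarrow>\<^sub>0 ('n, 'k) mpoly))"
  by unfold_locales
    (simp_all only: smult_vec_alg ring_homD(2)[OF ring_hom_Const] ring_homD(3)[OF ring_hom_Const] ring_homD(4)[OF ring_hom_Const])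

definition locally_finite :: "(nat \<Rightarrow> int) \<Rightarrow> nat set \<Rightarrow> bool" where
  "locally_finite \<delta> B \<longleftrightarrow> (\<forall>b\<in>B. 0 \<le> \<delta> b) \<and> (\<forall>d. finite {b\<in>B. \<delta> b = d})"

definition graded_submodule :: "(nat \<Rightarrow> int) \<Rightarrow> nat set \<Rightarrow> (nat \<Rightarrow>\<^sub>0 ('n::finite, 'k::field) mpoly) set \<Rightarrow> bool" where
  "graded_submodule \<delta> B Z \<longleftrightarrow> Z \<subseteq> free_module B \<and> 0 \<in> Z \<and> (\<forall>v\<in>Z. \<forall>w\<in>Z. v + w \<in> Z) \<and>
     (\<forall>a. \<forall>v\<in>Z. smult_vec a v \<in> Z) \<and> (\<forall>d. \<forall>v\<in>Z. hcomp_vec \<delta> d v \<in> Z)"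

text \<open>There are only finitely many products of a monomial and a generator of total degree \<open>d\<close>.\<close>

lemma forms_finite_span:
  fixes Z :: "(nat \<Rightarrow>\<^sub>0 ('n::finite, 'k::field) mpoly) set"
  assumes B: "locally_finite \<delta> B" and Z: "Z \<subseteq> free_module B"
  obtains S where "finite S" "S \<subseteq> {z\<in>Z. form_vec \<delta> d z}"
    "{z\<in>Z. form_vec \<delta> d z} \<subseteq> module.span (\<lambda>c. smult_vec (Const c)) S"
proof -
  interpret vector_space "\<lambda>(c::'k) (v :: nat \<Rightarrow>\<^sub>0 ('n, 'k) mpoly). smult_vec (Const c) v"
    by (rule vector_space_scale_Const)
  define M where "M = (\<lambda>(b, t). Poly_Mapping.single b (Poly_Mapping.single t 1) :: nat \<Rightarrow>\<^sub>0 ('n, 'k) mpoly) `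
    ((\<Union>d'\<in>{0..d}. {b\<in>B. \<delta> b = d'}) \<times> {t. mdeg t \<le> nat d})"
  have finM: "finite M"
    unfolding M_def using B by (intro finite_imageI finite_cartesian_product finite_UN_I finite_mdeg_le) (auto simp: locally_finite_def)
  have sub: "{z\<in>Z. form_vec \<delta> d z} \<subseteq> span M"
  proof
    fix z assume "z \<in> {z\<in>Z. form_vec \<delta> d z}"
    then have z: "z \<in> free_module B" "form_vec \<delta> d z" using Z by auto
    have "z = (\<Sum>b\<in>Poly_Mapping.keys z. \<Sum>t\<in>Poly_Mapping.keys (Poly_Mapping.lookup z b).
        smult_vec (Const (Poly_Mapping.lookup (Poly_Mapping.lookup z b) t)) (Poly_Mapping.single b (Poly_Mapping.single t 1)))"
    proof -
      have eq: "(\<Sum>t\<in>Poly_Mapping.keys f. smult_vec (Const (Poly_Mapping.lookup f t)) (Poly_Mapping.single b (Poly_Mapping.single t 1)))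
          = Poly_Mapping.single b f" for b :: nat and f :: "('n, 'k) mpoly"
      proof (rule poly_mapping_eqI)
        fix c
        show "Poly_Mapping.lookup (\<Sum>t\<in>Poly_Mapping.keys f. smult_vec (Const (Poly_Mapping.lookup f t)) (Poly_Mapping.single b (Poly_Mapping.single t 1))) c
          = Poly_Mapping.lookup (Poly_Mapping.single b f) c"
          by (cases "b = c") (simp_all add: lookup_sum lookup_single Const_def mult_single sum_single)
      qed
      show ?thesis by (simp only: eq sum_single)
    qed
    also have "\<dots> \<in> span M"
    proof (intro span_sum span_scale span_base)
      fix b t assume b: "b \<in> Poly_Mapping.keys z" and t: "t \<in> Poly_Mapping.keys (Poly_Mapping.lookup z b)"
      have "b \<in> B" using b z(1) by (auto simp: free_module_def)
      moreover have "int (mdeg t) = d - \<delta> b" using z(2) t by (auto simp: form_vec_def form_def)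
      ultimately show "Poly_Mapping.single b (Poly_Mapping.single t 1) \<in> M"
        unfolding M_def using B by (intro image_eqI[of _ _ "(b, t)"]) (auto simp: locally_finite_def)
    qed
    finally show "z \<in> span M" .
  qed
  obtain S where S: "S \<subseteq> {z\<in>Z. form_vec \<delta> d z}" "independent S" "{z\<in>Z. form_vec \<delta> d z} \<subseteq> span S"
    by (rule maximal_independent_subset)
  moreover have "finite S" using independent_span_bound[OF finM S(2)] S(1) sub by blast
  ultimately show thesis using that by blast
qed

lemma sum_hcomp_vec:
  fixes z :: "nat \<Rightarrow>\<^sub>0 ('n::finite, 'k::field) mpoly"
  obtains D where "finite D" "(\<Sum>d\<in>D. hcomp_vec \<delta> d z) = z" "\<And>d. d \<in> D \<Longrightarrow> \<exists>b\<in>Poly_Mapping.keys z. \<delta> b \<le> d"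
proof -
  define D where "D = (\<Union>b\<in>Poly_Mapping.keys z. (\<lambda>t. int (mdeg t) + \<delta> b) ` Poly_Mapping.keys (Poly_Mapping.lookup z b))"
  have fin: "finite D" by (simp add: D_def)
  have "(\<Sum>d\<in>D. hcomp_vec \<delta> d z) = z"
  proof (intro poly_mapping_eqI)
    fix b t
    have "Poly_Mapping.lookup (Poly_Mapping.lookup (\<Sum>d\<in>D. hcomp_vec \<delta> d z) b) t =
        (\<Sum>d\<in>D. if d = int (mdeg t) + \<delta> b then Poly_Mapping.lookup (Poly_Mapping.lookup z b) t else 0)"
      unfolding lookup_sum by (intro sum.cong) (auto simp: lookup_hcomp_vec lookup_hcomp)
    also have "\<dots> = Poly_Mapping.lookup (Poly_Mapping.lookup z b) t"
    proof -
      have "int (mdeg t) + \<delta> b \<in> D" if "Poly_Mapping.lookup (Poly_Mapping.lookup z b) t \<noteq> 0"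
      proof -
        have "b \<in> Poly_Mapping.keys z" using that by (auto simp: in_keys_iff)
        then show ?thesis unfolding D_def using that by (intro UN_I[of b] imageI) (simp_all add: in_keys_iff)
      qed
      then show ?thesis using fin by auto
    qed
    finally show "Poly_Mapping.lookup (Poly_Mapping.lookup (\<Sum>d\<in>D. hcomp_vec \<delta> d z) b) t =
      Poly_Mapping.lookup (Poly_Mapping.lookup z b) t" .
  qed
  moreover have "\<exists>b\<in>Poly_Mapping.keys z. \<delta> b \<le> d" if "d \<in> D" for d
  proof -
    from that obtain b and t :: "'n \<Rightarrow>\<^sub>0 nat" where "b \<in> Poly_Mapping.keys z" "d = int (mdeg t) + \<delta> b" unfolding D_def by auto
    then show ?thesis by (intro bexI[of _ b]) simp_all
  qed
  ultimately show thesis using fin by (intro that)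
qed

text \<open>For every degree \<open>d\<close>, a finite set spanning the forms of degree \<open>d\<close> in \<open>Z\<close> over the field is taken
  as the set of generators of degree \<open>d\<close>. The \<open>k\<close>-th of them gets the index \<open>prod_encode (d, k)\<close>;
  the lower bound on the degrees makes it possible to use a natural number for \<open>d\<close>.\<close>

lemma graded_cover:
  fixes Z :: "(nat \<Rightarrow>\<^sub>0 ('n::finite, 'k::field) mpoly) set"
  assumes B: "locally_finite \<delta> B" and Z: "graded_submodule \<delta> B Z"
  obtains B' \<delta>' D where "locally_finite \<delta>' B'" "graded_map \<delta>' B' \<delta> B D" "lin_ext D ` free_module B' = Z"
proof -
  interpret vector_space "\<lambda>(c::'k) (v :: nat \<Rightarrow>\<^sub>0 ('n, 'k) mpoly). smult_vec (Const c) v"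
    by (rule vector_space_scale_Const)
  have sub: "Z \<subseteq> free_module B" using Z by (simp add: graded_submodule_def)
  have "\<forall>d. \<exists>xs. set xs \<subseteq> {z\<in>Z. form_vec \<delta> d z} \<and> {z\<in>Z. form_vec \<delta> d z} \<subseteq> span (set xs)"
  proof
    fix d
    obtain S where S: "finite S" "S \<subseteq> {z\<in>Z. form_vec \<delta> d z}" "{z\<in>Z. form_vec \<delta> d z} \<subseteq> span S"
      using forms_finite_span[OF B sub] .
    obtain xs where "set xs = S" using finite_list[OF S(1)] by blast
    with S show "\<exists>xs. set xs \<subseteq> {z\<in>Z. form_vec \<delta> d z} \<and> {z\<in>Z. form_vec \<delta> d z} \<subseteq> span (set xs)" by blast
  qed
  from choice[OF this] obtain ls where ls: "\<And>d. set (ls d) \<subseteq> {z\<in>Z. form_vec \<delta> d z}"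
    "\<And>d. {z\<in>Z. form_vec \<delta> d z} \<subseteq> span (set (ls d))"
    by blast
  define dg where "dg n = fst (prod_decode n)" for n
  define ix where "ix n = snd (prod_decode n)" for n
  define B' where "B' = {n. ix n < length (ls (int (dg n)))}"
  define \<delta>' where "\<delta>' n = int (dg n)" for n
  define D where "D n = ls (int (dg n)) ! ix n" for n
  have D: "D n \<in> Z" "form_vec \<delta> (\<delta>' n) (D n)" if "n \<in> B'" for n
    using subsetD[OF ls(1)[of "int (dg n)"] nth_mem[of "ix n"]] that by (auto simp: B'_def D_def \<delta>'_def)
  have "{n\<in>B'. \<delta>' n = d} \<subseteq> prod_encode ` ({nat d} \<times> {..<length (ls d)})" for d
  proof
    fix n assume "n \<in> {n\<in>B'. \<delta>' n = d}"
    then have "prod_decode n \<in> {nat d} \<times> {..<length (ls d)}"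
      by (auto simp: B'_def \<delta>'_def dg_def ix_def mem_Times_iff)
    then show "n \<in> prod_encode ` ({nat d} \<times> {..<length (ls d)})"
      by (rule image_eqI[rotated]) simp
  qed
  then have "finite {n\<in>B'. \<delta>' n = d}" for d by (rule finite_subset) auto
  then have lf: "locally_finite \<delta>' B'" by (simp add: locally_finite_def \<delta>'_def)
  have gm: "graded_map \<delta>' B' \<delta> B D" using D sub by (auto simp: graded_map_def)
  have Zsum: "sum f S \<in> Z" if "\<And>s. s \<in> S \<Longrightarrow> f s \<in> Z" for f and S :: "nat set"
    using that by (induction S rule: infinite_finite_induct) (use Z in \<open>auto simp: graded_submodule_def\<close>)
  have im1: "lin_ext D v \<in> Z" if "v \<in> free_module B'" for v
    unfolding lin_ext_def using D Z that by (intro Zsum) (auto simp: graded_submodule_def free_module_def)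
  let ?Im = "lin_ext D ` free_module B'"
  have Im_add: "x + y \<in> ?Im" if xy: "x \<in> ?Im" "y \<in> ?Im" for x y
  proof -
    from xy obtain u w where "u \<in> free_module B'" "w \<in> free_module B'" "x = lin_ext D u" "y = lin_ext D w" by auto
    then show ?thesis by (intro image_eqI[of _ _ "u + w"]) (auto simp: lin_ext_add)
  qed
  have Im_smult: "smult_vec a x \<in> ?Im" if x: "x \<in> ?Im" for a x
  proof -
    from x obtain u where "u \<in> free_module B'" "x = lin_ext D u" by auto
    then show ?thesis by (intro image_eqI[of _ _ "smult_vec a u"]) (auto simp: lin_ext_smult)
  qed
  have Im_zero: "0 \<in> ?Im" by (intro image_eqI[of _ _ 0]) auto
  have Im_sum: "sum f S \<in> ?Im" if "\<And>s. s \<in> S \<Longrightarrow> f s \<in> ?Im" for f and S :: "int set"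
    using that by (induction S rule: infinite_finite_induct) (auto intro: Im_zero Im_add)
  have Im_sub: "module.subspace (\<lambda>c. smult_vec (Const c)) ?Im"
    unfolding module.subspace_def[OF module_axioms] using Im_add Im_smult Im_zero by auto
  have im2: "z \<in> ?Im" if z: "z \<in> Z" for z
  proof -
    obtain Ds where Ds: "finite Ds" "(\<Sum>d\<in>Ds. hcomp_vec \<delta> d z) = z" "\<And>d. d \<in> Ds \<Longrightarrow> \<exists>b\<in>Poly_Mapping.keys z. \<delta> b \<le> d"
      by (rule sum_hcomp_vec[of \<delta> z]) blast
    have "hcomp_vec \<delta> d z \<in> ?Im" if d: "d \<in> Ds" for d
    proof -
      obtain b where "b \<in> Poly_Mapping.keys z" "\<delta> b \<le> d" using Ds(3)[OF d] by blast
      moreover have "b \<in> B" using calculation(1) z sub by (auto simp: free_module_def)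
      ultimately have d0: "0 \<le> d" using B by (fastforce simp: locally_finite_def)
      have "set (ls d) \<subseteq> ?Im"
      proof
        fix x assume "x \<in> set (ls d)"
        then obtain k where k: "k < length (ls d)" "x = ls d ! k" by (auto simp: in_set_conv_nth)
        let ?n = "prod_encode (nat d, k)"
        have n: "dg ?n = nat d" "ix ?n = k" by (simp_all add: dg_def ix_def)
        then have "?n \<in> B'" "D ?n = x" using k d0 by (simp_all add: B'_def D_def)
        then show "x \<in> ?Im" by (intro image_eqI[of _ _ "Poly_Mapping.single ?n 1"]) auto
      qed
      then have "span (set (ls d)) \<subseteq> ?Im" using Im_sub by (rule span_minimal)
      moreover have "hcomp_vec \<delta> d z \<in> {z\<in>Z. form_vec \<delta> d z}"
        using Z z by (simp add: graded_submodule_def form_vec_hcomp)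
      ultimately show ?thesis using ls(2) by blast
    qed
    then show ?thesis using Im_sum[of Ds "\<lambda>d. hcomp_vec \<delta> d z"] Ds(2) by simp
  qed
  have "?Im = Z" using im1 im2 by blast
  with lf gm show thesis by (rule that)
qed

lemma hcomp_vec_zero [simp]: "hcomp_vec \<delta> d 0 = 0"
  by (rule poly_mapping_eqI) (simp add: lookup_hcomp_vec)

lemma graded_submodule_kernel:
  assumes "graded_map \<delta>' B' \<delta> B D"
  shows "graded_submodule \<delta>' B' {v \<in> free_module B'. lin_ext D v = 0}"
proof -
  have "lin_ext D (hcomp_vec \<delta>' d v) = 0" if "v \<in> free_module B'" "lin_ext D v = 0" for d v
    using graded_map_lin_ext(3)[OF assms that(1), of d] that(2) by simp
  then show ?thesis
    by (auto simp: graded_submodule_def lin_ext_add lin_ext_smult hcomp_vec_free_module)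
qed

text \<open>The resolution starts with the projection of \<open>R\<close> onto \<open>R/I\<close> and covers, step by step, the kernel of
  the previous map. Local finiteness is passed on, so that every step is possible.\<close>

lemma resolution_exists:
  fixes I :: "('n::finite, 'k::field) mpoly set"
  assumes I: "homogeneous_ideal I"
  obtains F where "graded_free_resolution I F" "\<And>i j. finite {b\<in>basis F i. gdeg F i b = j}"
proof -
  have id: "is_ideal I" and hom: "\<And>f d. f \<in> I \<Longrightarrow> hcomp d f \<in> I" using I by (auto simp: homogeneous_ideal_iff)
  \<comment> \<open>A stage is a free module, given by its basis and degrees, with the map to the previous module
    and the submodule that the next stage has to cover. The map of the first stage is arbitrary.\<close>
  define Z0 where "Z0 = {v \<in> free_module {0::nat}. Poly_Mapping.lookup v 0 \<in> I}"
  define x0 where "x0 = ({0::nat}, \<lambda>b::nat. 0::int, \<lambda>b::nat. 0 :: nat \<Rightarrow>\<^sub>0 ('n, 'k) mpoly, Z0)"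
  define P where "P i x \<longleftrightarrow> (case x of (B, \<delta>, D, Z) \<Rightarrow> locally_finite \<delta> B \<and> graded_submodule \<delta> B Z) \<and> (i = 0 \<longrightarrow> x = x0)"
    for i :: nat and x :: "nat set \<times> (nat \<Rightarrow> int) \<times> (nat \<Rightarrow> (nat \<Rightarrow>\<^sub>0 ('n, 'k) mpoly)) \<times> (nat \<Rightarrow>\<^sub>0 ('n, 'k) mpoly) set"
  define Q where "Q i x x' \<longleftrightarrow> (case x of (B, \<delta>, D, Z) \<Rightarrow> case x' of (B', \<delta>', D', Z') \<Rightarrow>
      graded_map \<delta>' B' \<delta> B D' \<and> lin_ext D' ` free_module B' = Z \<and> Z' = {v \<in> free_module B'. lin_ext D' v = 0})"
    for i :: nat and x x' :: "nat set \<times> (nat \<Rightarrow> int) \<times> (nat \<Rightarrow> (nat \<Rightarrow>\<^sub>0 ('n, 'k) mpoly)) \<times> (nat \<Rightarrow>\<^sub>0 ('n, 'k) mpoly) set"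
  have base: "\<exists>x. P 0 x"
  proof -
    have "graded_submodule (\<lambda>b. 0) {0} Z0"
      using id hom by (auto simp: graded_submodule_def Z0_def is_ideal_def lookup_add lookup_hcomp_vec hcomp_vec_free_module)
    moreover have "locally_finite (\<lambda>b. 0) {0}" by (simp add: locally_finite_def)
    ultimately show ?thesis by (intro exI[of _ x0]) (simp add: P_def x0_def)
  qed
  have step: "\<exists>x'. P (Suc i) x' \<and> Q i x x'" if Px: "P i x" for i x
  proof -
    obtain B \<delta> D Z where x: "x = (B, \<delta>, D, Z)" by (cases x)
    with Px have BZ: "locally_finite \<delta> B" "graded_submodule \<delta> B Z" by (auto simp: P_def)
    obtain B' \<delta>' D' where n: "locally_finite \<delta>' B'" "graded_map \<delta>' B' \<delta> B D'" "lin_ext D' ` free_module B' = Z"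
      by (rule graded_cover[OF BZ])
    then show ?thesis using graded_submodule_kernel[OF n(2)]
      by (intro exI[of _ "(B', \<delta>', D', {v \<in> free_module B'. lin_ext D' v = 0})"]) (simp add: P_def Q_def x)
  qed
  obtain f where f: "\<And>i. P i (f i)" "\<And>i. Q i (f i) (f (Suc i))"
    using dependent_nat_choice[of P Q, OF base step] by blast
  define F where "F = \<lparr>basis = (\<lambda>i. fst (f i)), gdeg = (\<lambda>i. fst (snd (f i))),
    diff = (\<lambda>i. fst (snd (snd (f (Suc i))))), aug = (\<lambda>_. 1 :: ('n, 'k) mpoly)\<rparr>"
  define Z where "Z i = snd (snd (snd (f i)))" for i
  have Pi: "locally_finite (gdeg F i) (basis F i)" for i
    using f(1)[of i] by (auto simp: P_def F_def split: prod.splits)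
  have Qi: "graded_map (gdeg F (Suc i)) (basis F (Suc i)) (gdeg F i) (basis F i) (diff F i)"
    "diff_map F i ` free_module (basis F (Suc i)) = Z i"
    "Z (Suc i) = {v \<in> free_module (basis F (Suc i)). diff_map F i v = 0}" for i
    using f(2)[of i] by (auto simp: Q_def F_def Z_def diff_map_def split: prod.splits)
  have f0: "f 0 = x0" using f(1)[of 0] by (simp add: P_def)
  have F0: "basis F 0 = {0}" "gdeg F 0 = (\<lambda>_. 0)" "Z 0 = Z0" "aug F = (\<lambda>_. 1)"
    using f0 by (simp_all add: F_def x0_def Z_def)
  have augF: "aug_map F v = Poly_Mapping.lookup v 0" if "v \<in> free_module {0}" for v
    using that by (subst lookup_aug_map[of "{0}"]) (auto simp: free_module_def F0)
  have "graded_free_resolution I F"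
    unfolding graded_free_resolution_alt
  proof (intro conjI allI ballI)
    show "form (gdeg F 0 b) (aug F b)" for b by (simp add: F0 form_def mdeg_def)
    show "graded_map (gdeg F (Suc i)) (basis F (Suc i)) (gdeg F i) (basis F i) (diff F i)" for i by (rule Qi)
    show "\<exists>v\<in>free_module (basis F 0). g - aug_map F v \<in> I" for g
      using id by (intro bexI[of _ "Poly_Mapping.single 0 g"]) (auto simp: F0 augF is_ideal_def)
    show "syz I F i = diff_map F i ` free_module (basis F (Suc i))" for i
    proof (cases i)
      case 0
      have "syz I F 0 = Z0" by (auto simp: syz_def Z0_def F0 augF)
      then show ?thesis using 0 Qi(2)[of 0] F0 by simp
    next
      case (Suc i')
      then show ?thesis using Qi(2)[of i] Qi(3)[of i'] by (simp add: syz_def)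
    qed
  qed
  moreover have "finite {b\<in>basis F i. gdeg F i b = j}" for i j using Pi[of i] by (simp add: locally_finite_def)
  ultimately show thesis by (rule that)
qed

section \<open>Vanishing of Betti numbers\<close>

text \<open>Finite dimension of Tor, which excludes a Betti number that is \<open>0\<close> by convention, comes from \<open>L\<close>;
  the vanishing can be tested on any resolution.\<close>

lemma betti_nonzero_iff:
  assumes I: "homogeneous_ideal I" and F: "graded_free_resolution I F"
    and L: "graded_free_resolution I L" "finite {b\<in>basis L i. gdeg L i b = j}"
  shows "betti I i j \<noteq> 0 \<longleftrightarrow> \<not> tor_cycles F i j \<subseteq> tor_boundaries F i j"
proof -
  define G where "G = (SOME F. graded_free_resolution I F)"
  have G: "graded_free_resolution I G" unfolding G_def using F by (rule someI)
  have trans: "tor_cycles B i j \<subseteq> tor_boundaries B i j"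
    if A: "graded_free_resolution I A" and B: "graded_free_resolution I B" and AB: "tor_cycles A i j \<subseteq> tor_boundaries A i j" for A B
  proof
    fix v assume v: "v \<in> tor_cycles B i j"
    obtain M where M: "\<And>v. v \<in> tor_boundaries A i j \<Longrightarrow> M v \<in> tor_boundaries B i j"
      "\<And>v. v \<in> tor_cycles B i j \<Longrightarrow> \<exists>u\<in>tor_cycles A i j. v - M u \<in> tor_boundaries B i j"
      using tor_surjective[OF I A B] by metis
    obtain u where u: "u \<in> tor_cycles A i j" "v - M u \<in> tor_boundaries B i j" using M(2) v by blast
    have "M u \<in> tor_boundaries B i j" using M(1) AB u(1) by blast
    with u(2) have "(v - M u) + M u \<in> tor_boundaries B i j"
      using subspace_tor_boundaries[of B i j] unfolding vec_subspace_def by blast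
    then show "v \<in> tor_boundaries B i j" by simp
  qed
  have "finite_mod (tor_cycles G i j) (tor_boundaries G i j)"
  proof -
    obtain M where M: "\<And>a v. M (smult_vec a v) = smult_vec a (M v)" "\<And>v w. M (v + w) = M v + M w"
      "\<And>v. v \<in> tor_cycles G i j \<Longrightarrow> \<exists>u\<in>tor_cycles L i j. v - M u \<in> tor_boundaries G i j"
      using tor_surjective[OF I L(1) G] by metis
    have M0: "M 0 = 0" by (metis add_cancel_right_left M(2))
    have M_sum: "M (sum f S) = (\<Sum>s\<in>S. M (f s))" for f and S :: "nat set"
      by (induction S rule: infinite_finite_induct) (auto simp: M0 M(2))
    let ?B = "{b\<in>basis L i. gdeg L i b = j}" and ?m = "\<lambda>b. M (Poly_Mapping.single b 1)"
    have span: "\<exists>u'. M u = (\<Sum>s\<in>?m ` ?B. smult_vec (u' s) s)" if "u \<in> tor_cycles L i j" for u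
    proof -
      interpret vector_space "smult_vec :: 'b \<Rightarrow> (nat \<Rightarrow>\<^sub>0 'b) \<Rightarrow> _" by (rule vector_space_smult_vec)
      have "Poly_Mapping.keys u \<subseteq> ?B"
        using that by (auto simp: tor_cycles_def tensor_part_def free_module_def split: nat.splits)
      then have "(\<Sum>b\<in>Poly_Mapping.keys u. smult_vec (Poly_Mapping.lookup u b) (?m b)) \<in> span (?m ` ?B)"
        by (intro span_sum span_scale span_base imageI) (rule subsetD)
      moreover have "M u = (\<Sum>b\<in>Poly_Mapping.keys u. smult_vec (Poly_Mapping.lookup u b) (?m b))"
        by (subst lin_ext_id[symmetric]) (simp only: lin_ext_def M_sum M(1))
      ultimately have "M u \<in> span (?m ` ?B)" by (simp only:)
      then show ?thesis using span_finite[of "?m ` ?B"] L(2) by auto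
    qed
    have "\<exists>u'. v - (\<Sum>s\<in>?m ` ?B. smult_vec (u' s) s) \<in> tor_boundaries G i j" if v: "v \<in> tor_cycles G i j" for v
    proof -
      obtain u where u: "u \<in> tor_cycles L i j" "v - M u \<in> tor_boundaries G i j" using M(3)[OF v] by blast
      obtain u' where "M u = (\<Sum>s\<in>?m ` ?B. smult_vec (u' s) s)" using span[OF u(1)] by blast
      then show ?thesis using u(2) by (intro exI[of _ u']) (simp only:)
    qed
    then show ?thesis unfolding finite_mod_def using L(2) by (intro exI[of _ "?m ` ?B"]) auto
  qed
  from quotient_dim_nonzero_iff[OF subspace_tor_cycles subspace_tor_boundaries boundaries_cycles[OF G] this]
  have "betti I i j \<noteq> 0 \<longleftrightarrow> \<not> tor_cycles G i j \<subseteq> tor_boundaries G i j"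
    by (simp add: betti_def G_def[symmetric] Let_def)
  also have "\<dots> \<longleftrightarrow> \<not> tor_cycles F i j \<subseteq> tor_boundaries F i j" using trans[OF F G] trans[OF G F] by metis
  finally show ?thesis .
qed

section \<open>Additive maps on polynomials\<close>

lemma additive_sum:
  fixes F :: "'a::comm_monoid_add \<Rightarrow> 'b::ab_group_add"
  assumes "\<And>x y. F (x + y) = F x + F y"
  shows "F (sum f S) = (\<Sum>s\<in>S. F (f s))"
proof -
  have "F 0 = 0" using assms[of 0 0] by simp
  then show ?thesis by (induction S rule: infinite_finite_induct) (auto simp: assms)
qed

text \<open>Identities between additive maps are checked on monomials below, which turns the ring axioms for
  power maps into arithmetic of exponents.\<close>

lemma additive_eqI:
  fixes F G :: "('a \<Rightarrow>\<^sub>0 'r::comm_monoid_add) \<Rightarrow> 'b::ab_group_add"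
  assumes "\<And>x y. F (x + y) = F x + F y" "\<And>x y. G (x + y) = G x + G y"
    "\<And>t c. F (Poly_Mapping.single t c) = G (Poly_Mapping.single t c)"
  shows "F f = G f"
proof -
  have "F (\<Sum>t\<in>Poly_Mapping.keys f. Poly_Mapping.single t (Poly_Mapping.lookup f t)) =
      G (\<Sum>t\<in>Poly_Mapping.keys f. Poly_Mapping.single t (Poly_Mapping.lookup f t))"
    by (simp add: additive_sum[of F, OF assms(1)] additive_sum[of G, OF assms(2)] assms(3))
  then show ?thesis by (simp add: sum_single)
qed

definition mono_ext :: "('a \<Rightarrow> 'r \<Rightarrow> 'b) \<Rightarrow> ('a \<Rightarrow>\<^sub>0 'r::comm_monoid_add) \<Rightarrow> 'b::ab_group_add" where
  "mono_ext h f = (\<Sum>t\<in>Poly_Mapping.keys f. h t (Poly_Mapping.lookup f t))"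

lemma mono_ext_single: "h t 0 = 0 \<Longrightarrow> mono_ext h (Poly_Mapping.single t c) = h t c"
  by (cases "c = 0") (simp_all add: mono_ext_def)

lemma mono_ext_superset:
  assumes "\<And>t. h t 0 = 0" "finite A" "Poly_Mapping.keys f \<subseteq> A"
  shows "mono_ext h f = (\<Sum>t\<in>A. h t (Poly_Mapping.lookup f t))"
  unfolding mono_ext_def by (rule sum.mono_neutral_left) (use assms in \<open>auto simp: in_keys_iff\<close>)

lemma mono_ext_add:
  assumes "\<And>t c d. h t (c + d) = h t c + h t d"
  shows "mono_ext h (f + g) = mono_ext h f + mono_ext h g"
proof -
  have z: "h t 0 = 0" for t using assms[of t 0 0] by simp
  let ?A = "Poly_Mapping.keys f \<union> Poly_Mapping.keys g"
  have "Poly_Mapping.keys (f + g) \<subseteq> ?A" by (rule keys_add)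
  then show ?thesis
    by (simp add: mono_ext_superset[of h ?A, OF z] lookup_add assms sum.distrib)
qed

section \<open>Power maps\<close>

definition mscale :: "nat \<Rightarrow> ('n \<Rightarrow>\<^sub>0 nat) \<Rightarrow> ('n \<Rightarrow>\<^sub>0 nat)" where
  "mscale m t = Poly_Mapping.map (\<lambda>k. m * k) t"

definition mdiv :: "nat \<Rightarrow> ('n \<Rightarrow>\<^sub>0 nat) \<Rightarrow> ('n \<Rightarrow>\<^sub>0 nat)" where
  "mdiv m t = Poly_Mapping.map (\<lambda>k. k div m) t"

definition mmod :: "nat \<Rightarrow> ('n \<Rightarrow>\<^sub>0 nat) \<Rightarrow> ('n \<Rightarrow>\<^sub>0 nat)" where
  "mmod m t = Poly_Mapping.map (\<lambda>k. k mod m) t"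

lemma lookup_mscale: "Poly_Mapping.lookup (mscale m t) x = m * Poly_Mapping.lookup t x"
  and lookup_mdiv: "Poly_Mapping.lookup (mdiv m t) x = Poly_Mapping.lookup t x div m"
  and lookup_mmod: "Poly_Mapping.lookup (mmod m t) x = Poly_Mapping.lookup t x mod m"
  by (simp_all add: mscale_def mdiv_def mmod_def lookup_map)

lemma mscale_add: "mscale m (s + t) = mscale m s + mscale m t"
  and mscale_zero: "mscale m 0 = 0"
  and mmod_mdiv: "mmod m t + mscale m (mdiv m t) = t"
  and mmod_mscale: "mmod m (mscale m s + t) = mmod m t"
  by (auto intro!: poly_mapping_eqI simp: lookup_mscale lookup_mdiv lookup_mmod lookup_add algebra_simps)

lemma mdiv_mscale: "m > 0 \<Longrightarrow> mdiv m (mscale m s + t) = s + mdiv m t"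
  by (auto intro!: poly_mapping_eqI simp: lookup_mscale lookup_mdiv lookup_add)

lemma mscale_eq_0: "m > 0 \<Longrightarrow> mscale m t = 0 \<longleftrightarrow> t = 0"
  by (auto simp: poly_mapping_eq_iff fun_eq_iff lookup_mscale)

lemma mdeg_mscale: "mdeg (mscale m t) = m * mdeg t"
  by (simp add: mdeg_def lookup_mscale sum_distrib_left)

text \<open>The endomorphism \<open>\<psi>\<close>: coefficients are moved by \<open>\<sigma>\<close> and variables are replaced by their \<open>m\<close>-th
  powers.\<close>

definition power_map :: "('k \<Rightarrow> 'k) \<Rightarrow> nat \<Rightarrow> ('n::finite, 'k::field) mpoly \<Rightarrow> ('n, 'k) mpoly" where
  "power_map \<sigma> m = mono_ext (\<lambda>t c. Poly_Mapping.single (mscale m t) (\<sigma> c))"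

context
  fixes \<sigma> :: "'k::field \<Rightarrow> 'k" and m :: nat
  assumes \<sigma>: "ring_hom \<sigma>" and m: "m > 0"
begin

lemma power_map_add: "power_map \<sigma> m (f + g) = power_map \<sigma> m f + power_map \<sigma> m g"
  unfolding power_map_def by (rule mono_ext_add) (simp add: ring_homD(3)[OF \<sigma>] single_add)

lemma power_map_single:
  "power_map \<sigma> m (Poly_Mapping.single t c) = Poly_Mapping.single (mscale m t) (\<sigma> c)"
  unfolding power_map_def by (rule mono_ext_single) (simp add: ring_homD(1)[OF \<sigma>])

lemma power_map_hom: "ring_hom (power_map \<sigma> m :: ('n::finite, 'k) mpoly \<Rightarrow> _)"
  unfolding ring_hom_def
proof (intro conjI allI)
  show "power_map \<sigma> m (1 :: ('n, 'k) mpoly) = 1"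
    unfolding single_one[symmetric] power_map_single by (simp add: mscale_zero ring_homD(2)[OF \<sigma>])
  fix f g :: "('n, 'k) mpoly"
  show "power_map \<sigma> m (f + g) = power_map \<sigma> m f + power_map \<sigma> m g" by (rule power_map_add)
  show "power_map \<sigma> m (f * g) = power_map \<sigma> m f * power_map \<sigma> m g"
  proof (rule additive_eqI[where F="\<lambda>f. power_map \<sigma> m (f * g)"])
    fix t c
    show "power_map \<sigma> m (Poly_Mapping.single t c * g) = power_map \<sigma> m (Poly_Mapping.single t c) * power_map \<sigma> m g"
      by (rule additive_eqI[where F="\<lambda>g. power_map \<sigma> m (Poly_Mapping.single t c * g)"])
        (simp_all add: power_map_single power_map_add mult_single mscale_add ring_homD(4)[OF \<sigma>] distrib_left)
  qed (simp_all add: power_map_add distrib_right)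
qed

lemma power_map_form:
  assumes "form d f" shows "form (int m * d) (power_map \<sigma> m f)"
proof -
  have "Poly_Mapping.keys (power_map \<sigma> m f) \<subseteq> mscale m ` Poly_Mapping.keys f"
    unfolding power_map_def mono_ext_def
    by (rule order_trans[OF keys_sum]) auto
  then show ?thesis using assms by (auto simp: form_def mdeg_mscale)
qed

lemma const_term_power_map: "const_term (power_map \<sigma> m f) = \<sigma> (const_term f)"
proof (rule additive_eqI[where F="\<lambda>f. const_term (power_map \<sigma> m f)"])
  show "const_term (power_map \<sigma> m (Poly_Mapping.single t c)) = \<sigma> (const_term (Poly_Mapping.single t c))" for t and c :: 'k
    by (simp add: power_map_single lookup_single when_def mscale_eq_0[OF m] ring_homD(1)[OF \<sigma>])
qed (simp_all add: power_map_add lookup_add ring_homD(3)[OF \<sigma>])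

text \<open>Write \<open>X\<^sup>u = X\<^sup>a (X\<^sup>s)\<^sup>m\<close> with \<open>a = u mod m\<close> and \<open>s = u div m\<close>, and expand the coefficient with respect to
  \<open>\<epsilon>\<close>. The coordinate for \<open>(j, a)\<close> collects the terms with remainder \<open>a\<close>.\<close>

lemma power_map_projective_extension:
  assumes "projective_extension \<sigma> \<epsilon> \<kappa>"
  defines "e \<equiv> \<lambda>(j, a). Poly_Mapping.single a (\<epsilon> j)"
    and "\<pi> \<equiv> \<lambda>(j, a). mono_ext (\<lambda>u c. if mmod m u = a then Poly_Mapping.single (mdiv m u) (\<kappa> j c) else 0)"
  shows "projective_extension (power_map \<sigma> m :: ('n::finite, 'k) mpoly \<Rightarrow> _) e \<pi>"
proof -
  interpret K: projective_extension \<sigma> \<epsilon> \<kappa> by (rule assms)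
  have add: "\<pi> (j, a) (f + g) = \<pi> (j, a) f + \<pi> (j, a) g" for j a and f g :: "('n, 'k) mpoly"
    unfolding \<pi>_def by (simp, rule mono_ext_add) (simp add: K.coord_add single_add)
  have single: "\<pi> (j, a) (Poly_Mapping.single u c) =
      (if mmod m u = a then Poly_Mapping.single (mdiv m u) (\<kappa> j c) else 0)" for j a u c
    unfolding \<pi>_def case_prod_conv by (rule mono_ext_single) (simp add: K.coord_zero)
  have mult: "\<pi> (j, a) (power_map \<sigma> m f * g) = f * \<pi> (j, a) g" for j a and f g :: "('n, 'k) mpoly"
  proof (rule additive_eqI[where F="\<lambda>f. \<pi> (j, a) (power_map \<sigma> m f * g)"])
    fix t c
    show "\<pi> (j, a) (power_map \<sigma> m (Poly_Mapping.single t c) * g) = Poly_Mapping.single t c * \<pi> (j, a) g"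
      by (rule additive_eqI[where F="\<lambda>g. \<pi> (j, a) (power_map \<sigma> m (Poly_Mapping.single t c) * g)"])
        (simp_all add: add power_map_single mult_single single distrib_left mmod_mscale mdiv_mscale[OF m] K.coord_mult)
  qed (simp_all add: power_map_add distrib_right add)
  define JJ where "JJ g = (\<Union>u\<in>Poly_Mapping.keys g. {j. \<kappa> j (Poly_Mapping.lookup g u) \<noteq> 0})" for g :: "('n, 'k) mpoly"
  define AA where "AA g = mmod m ` Poly_Mapping.keys g" for g :: "('n, 'k) mpoly"
  have fin: "finite (JJ g)" "finite (AA g)" for g by (auto simp: JJ_def AA_def K.coord_finite)
  have supp: "{j. \<pi> j g \<noteq> 0} \<subseteq> JJ g \<times> AA g" for g
  proof safe
    fix j a assume "\<pi> (j, a) g \<noteq> 0"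
    then obtain u where u: "u \<in> Poly_Mapping.keys g"
      "(if mmod m u = a then Poly_Mapping.single (mdiv m u) (\<kappa> j (Poly_Mapping.lookup g u)) else 0) \<noteq> 0"
      unfolding \<pi>_def mono_ext_def by (auto elim!: sum.not_neutral_contains_not_neutral)
    then have "mmod m u = a" "\<kappa> j (Poly_Mapping.lookup g u) \<noteq> 0" by (auto split: if_splits)
    then show "j \<in> JJ g" "a \<in> AA g" using u(1) by (auto simp: JJ_def AA_def)
  qed
  have expand: "(\<Sum>j\<in>JJ g \<times> AA g. e j * power_map \<sigma> m (\<pi> j g)) = g" for g
  proof -
    have z: "power_map \<sigma> m 0 = (0 :: ('n, 'k) mpoly)" by (rule ring_homD(1)[OF power_map_hom])
    have "(\<Sum>j\<in>JJ g \<times> AA g. e j * power_map \<sigma> m (\<pi> j g)) =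
        (\<Sum>(j, a)\<in>JJ g \<times> AA g. \<Sum>u\<in>Poly_Mapping.keys g.
          if mmod m u = a then Poly_Mapping.single u (\<epsilon> j * \<sigma> (\<kappa> j (Poly_Mapping.lookup g u))) else 0)"
    proof (intro sum.cong refl, clarify)
      fix j a
      have "e (j, a) * power_map \<sigma> m (\<pi> (j, a) g) =
        (\<Sum>u\<in>Poly_Mapping.keys g. Poly_Mapping.single a (\<epsilon> j) *
          power_map \<sigma> m (if mmod m u = a then Poly_Mapping.single (mdiv m u) (\<kappa> j (Poly_Mapping.lookup g u)) else 0))"
        unfolding e_def \<pi>_def mono_ext_def
        by (simp add: sum_distrib_left additive_sum[of "power_map \<sigma> m", OF power_map_add])
      also have "\<dots> = (\<Sum>u\<in>Poly_Mapping.keys g.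
          if mmod m u = a then Poly_Mapping.single u (\<epsilon> j * \<sigma> (\<kappa> j (Poly_Mapping.lookup g u))) else 0)"
        by (intro sum.cong refl) (auto simp: power_map_single mult_single mmod_mdiv z)
      finally show "e (j, a) * power_map \<sigma> m (\<pi> (j, a) g) = (\<Sum>u\<in>Poly_Mapping.keys g.
          if mmod m u = a then Poly_Mapping.single u (\<epsilon> j * \<sigma> (\<kappa> j (Poly_Mapping.lookup g u))) else 0)" .
    qed
    also have "\<dots> = (\<Sum>u\<in>Poly_Mapping.keys g. \<Sum>j\<in>JJ g. \<Sum>a\<in>AA g.
          if mmod m u = a then Poly_Mapping.single u (\<epsilon> j * \<sigma> (\<kappa> j (Poly_Mapping.lookup g u))) else 0)"
      unfolding sum.cartesian_product[symmetric]
      by (subst sum.swap, subst (2) sum.swap, subst sum.swap, rule sum.cong[OF refl], rule sum.swap)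
    also have "\<dots> = (\<Sum>u\<in>Poly_Mapping.keys g. \<Sum>j\<in>JJ g. Poly_Mapping.single u (\<epsilon> j * \<sigma> (\<kappa> j (Poly_Mapping.lookup g u))))"
      using fin by (intro sum.cong refl) (auto simp: AA_def)
    also have "\<dots> = (\<Sum>u\<in>Poly_Mapping.keys g. Poly_Mapping.single u (Poly_Mapping.lookup g u))"
    proof (intro sum.cong refl)
      fix u assume "u \<in> Poly_Mapping.keys g"
      then have "(\<Sum>j\<in>JJ g. \<epsilon> j * \<sigma> (\<kappa> j (Poly_Mapping.lookup g u))) = Poly_Mapping.lookup g u"
        by (intro K.coord_expand' fin) (auto simp: JJ_def)
      then show "(\<Sum>j\<in>JJ g. Poly_Mapping.single u (\<epsilon> j * \<sigma> (\<kappa> j (Poly_Mapping.lookup g u)))) =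
          Poly_Mapping.single u (Poly_Mapping.lookup g u)"
        using additive_sum[of "Poly_Mapping.single u", OF single_add, symmetric] by metis
    qed
    finally show ?thesis by (simp add: sum_single)
  qed
  show ?thesis
  proof
    fix j and f g :: "('n, 'k) mpoly"
    show "ring_hom (power_map \<sigma> m :: ('n, 'k) mpoly \<Rightarrow> _)" by (rule power_map_hom)
    show "\<pi> j (f + g) = \<pi> j f + \<pi> j g" using add by (cases j) simp
    show "\<pi> j (power_map \<sigma> m f * g) = f * \<pi> j g" using mult by (cases j) simp
    show "finite {j. \<pi> j g \<noteq> 0}" using finite_subset[OF supp finite_cartesian_product[OF fin]] .
    have "(\<Sum>j | \<pi> j g \<noteq> 0. e j * power_map \<sigma> m (\<pi> j g)) = (\<Sum>j\<in>JJ g \<times> AA g. e j * power_map \<sigma> m (\<pi> j g))"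
      using supp fin by (intro sum.mono_neutral_left) (auto simp: ring_homD(1)[OF power_map_hom])
    then show "g = (\<Sum>j | \<pi> j g \<noteq> 0. e j * power_map \<sigma> m (\<pi> j g))" by (simp add: expand)
  qed
qed

end

text \<open>The field is a vector space over itself with scalars acting through \<open>\<sigma>\<close>; coordinates are taken
  with respect to a basis. For the Frobenius endomorphism of an imperfect field this basis has
  more than one element.\<close>

lemma field_projective_extension:
  fixes \<sigma> :: "'k::field \<Rightarrow> 'k"
  assumes "ring_hom \<sigma>"
  obtains \<kappa> where "projective_extension \<sigma> (\<lambda>b. b) \<kappa>"
proof -
  interpret vector_space "\<lambda>a x. \<sigma> a * x"
    by unfold_locales (simp_all add: ring_homD[OF assms] algebra_simps)
  define B where "B = extend_basis {}"
  have B: "independent B" "span B = UNIV"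
    unfolding B_def by (simp_all add: independent_extend_basis span_extend_basis independent_empty)
  define \<kappa> where "\<kappa> b x = representation B x b" for b x
  have "projective_extension \<sigma> (\<lambda>b. b) \<kappa>"
  proof
    fix j f g
    show "ring_hom \<sigma>" by fact
    show "\<kappa> j (f + g) = \<kappa> j f + \<kappa> j g" using B by (simp add: \<kappa>_def representation_add)
    show "\<kappa> j (\<sigma> f * g) = f * \<kappa> j g" using B by (simp add: \<kappa>_def representation_scale)
    show "finite {j. \<kappa> j g \<noteq> 0}" by (simp add: \<kappa>_def finite_representation)
    show "g = (\<Sum>j | \<kappa> j g \<noteq> 0. j * \<sigma> (\<kappa> j g))"
      using sum_nonzero_representation_eq[OF B(1), of g] B(2) by (simp add: \<kappa>_def mult.commute)
  qed
  then show thesis by (rule that)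
qed

section \<open>Resolutions and Betti numbers of extended ideals\<close>

definition extend_complex :: "(('n::finite, 'k::field) mpoly \<Rightarrow> ('n, 'k) mpoly) \<Rightarrow> nat \<Rightarrow>
    ('n, 'k) free_complex \<Rightarrow> ('n, 'k) free_complex" where
  "extend_complex \<psi> m F = \<lparr>basis = basis F, gdeg = (\<lambda>i b. int m * gdeg F i b),
     diff = (\<lambda>i b. Poly_Mapping.map \<psi> (diff F i b)), aug = (\<lambda>b. \<psi> (aug F b))\<rparr>"

lemma extend_complex_simps [simp]:
  "basis (extend_complex \<psi> m F) = basis F"
  "gdeg (extend_complex \<psi> m F) i b = int m * gdeg F i b"
  "diff (extend_complex \<psi> m F) i b = Poly_Mapping.map \<psi> (diff F i b)"
  "aug (extend_complex \<psi> m F) b = \<psi> (aug F b)"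
  by (simp_all add: extend_complex_def)

lemma diff_map_extend_complex:
  "diff_map (extend_complex \<psi> m F) i = lin_ext (\<lambda>b. Poly_Mapping.map \<psi> (diff F i b))"
  by (simp add: diff_map_def extend_complex_def)

locale graded_projective_extension = projective_extension \<psi> e \<pi>
  for \<psi> :: "('n::finite, 'k::field) mpoly \<Rightarrow> ('n, 'k) mpoly" and e :: "'j \<Rightarrow> ('n, 'k) mpoly" and \<pi> +
  fixes m :: nat
  assumes form_scale: "form d f \<Longrightarrow> form (int m * d) (\<psi> f)"
begin

text \<open>The ideal is generated by the elements \<open>\<psi> g\<close> for the forms \<open>g\<close> in \<open>I\<close>, which are again forms.\<close>

lemma extended_ideal_homogeneous:
  assumes I: "homogeneous_ideal I"
  shows "homogeneous_ideal (extended_ideal \<psi> I)"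
  unfolding homogeneous_ideal_iff
proof (intro conjI ballI allI)
  show id: "is_ideal (extended_ideal \<psi> I)" by (rule extended_ideal_is_ideal)
  fix f d assume "f \<in> extended_ideal \<psi> I"
  then show "hcomp d f \<in> extended_ideal \<psi> I"
    unfolding extended_ideal_def
  proof (induction rule: module.span_induct_alt[OF module_mult, consumes 1, case_names base step])
    case base
    then show ?case by (simp add: module.span_zero[OF module_mult])
  next
    case (step c x y)
    then obtain g where g: "g \<in> I" "x = \<psi> g" by auto
    let ?D = "(int \<circ> mdeg) ` Poly_Mapping.keys g"
    have "hcomp d (c * x) = (\<Sum>d'\<in>?D. hcomp d (c * \<psi> (hcomp d' g)))"
      unfolding g(2) by (subst sum_hcomp[of g, symmetric]) (simp only: ring_homD(6)[OF hom] sum_distrib_left hcomp_sum)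
    also have "\<dots> = (\<Sum>d'\<in>?D. hcomp (d - int m * d') c * \<psi> (hcomp d' g))"
      by (intro sum.cong refl hcomp_mult_form form_scale form_hcomp)
    also have "\<dots> \<in> extended_ideal \<psi> I"
    proof (intro ideal_sum id)
      fix d'
      have "hcomp d' g \<in> I" using I g(1) by (simp add: homogeneous_ideal_iff)
      then show "hcomp (d - int m * d') c * \<psi> (hcomp d' g) \<in> extended_ideal \<psi> I"
        using id extended_ideal_base[of "hcomp d' g" I \<psi>] by (simp add: is_ideal_def)
    qed
    finally have "hcomp d (c * x) \<in> extended_ideal \<psi> I" .
    then show ?case using step id by (simp add: hcomp_add is_ideal_def extended_ideal_def)
  qed
qed

lemma aug_map_coords: "\<pi> j (aug_map (extend_complex \<psi> m F) v) = aug_map F (Poly_Mapping.map (\<pi> j) v)"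
proof -
  have "Poly_Mapping.keys (Poly_Mapping.map (\<pi> j) v) \<subseteq> Poly_Mapping.keys v"
    by (auto simp: in_keys_iff lookup_map coord_zero)
  moreover have "\<pi> j (a * \<psi> b) = \<pi> j a * b" for a b
    using coord_mult[of j b a] by (simp add: mult.commute)
  ultimately show ?thesis
    by (simp add: lookup_aug_map[of "Poly_Mapping.keys v"] coord_sum lookup_map coord_zero)
qed

lemma syz_iff_coords:
  assumes "is_ideal I"
  shows "v \<in> syz (extended_ideal \<psi> I) (extend_complex \<psi> m F) i \<longleftrightarrow>
    (\<forall>j. Poly_Mapping.map (\<pi> j) v \<in> syz I F i)"
proof (cases i)
  case 0
  then show ?thesis
    by (auto simp: syz_def free_module_iff_coords[of v] extended_ideal_iff_coords[OF assms] aug_map_coords)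
next
  case (Suc i')
  have "diff_map (extend_complex \<psi> m F) i' v = 0 \<longleftrightarrow> (\<forall>j. diff_map F i' (Poly_Mapping.map (\<pi> j) v) = 0)"
    unfolding diff_map_extend_complex diff_map_def[of F] by (rule kernel_iff_coords)
  then show ?thesis using Suc by (auto simp: syz_def free_module_iff_coords[of v])
qed

text \<open>Coordinates commute with the differentials and the augmentation, so a vector is a syzygy, or a
  boundary, of the extended complex if and only if all its coordinates are so in \<open>F\<close>.\<close>

lemma extend_resolution:
  assumes I: "homogeneous_ideal I" and F: "graded_free_resolution I F"
  shows "graded_free_resolution (extended_ideal \<psi> I) (extend_complex \<psi> m F)"
  unfolding graded_free_resolution_alt
proof (intro conjI allI ballI)
  let ?F = "extend_complex \<psi> m F"
  have id: "is_ideal I" using I by (simp add: homogeneous_ideal_iff)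
  show "form (gdeg ?F 0 b) (aug ?F b)" if "b \<in> basis ?F 0" for b
    using that by (simp add: form_scale resolution_aug[OF F])
  fix i
  show "graded_map (gdeg ?F (Suc i)) (basis ?F (Suc i)) (gdeg ?F i) (basis ?F i) (diff ?F i)"
    using resolution_diff[OF F, of i]
    by (auto simp: graded_map_def form_vec_def lookup_map ring_homD(1)[OF hom] form_scale right_diff_distrib[symmetric]
        map_free_module)
  have "v \<in> syz (extended_ideal \<psi> I) ?F i \<longleftrightarrow> v \<in> diff_map ?F i ` free_module (basis ?F (Suc i))" for v
  proof -
    have "v \<in> diff_map ?F i ` free_module (basis ?F (Suc i)) \<longleftrightarrow>
        v \<in> lin_ext (\<lambda>b. Poly_Mapping.map \<psi> (diff F i b)) ` free_module (basis F (Suc i))"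
      by (simp only: diff_map_extend_complex extend_complex_simps)
    then show ?thesis
      by (simp only: syz_iff_coords[OF id] resolution_exact[OF F] lin_ext_image_iff_coords diff_map_def)
  qed
  then show "syz (extended_ideal \<psi> I) ?F i = diff_map ?F i ` free_module (basis ?F (Suc i))" by blast
next
  let ?F = "extend_complex \<psi> m F"
  have id: "is_ideal I" using I by (simp add: homogeneous_ideal_iff)
  fix f
  have "\<forall>j. \<exists>v. v \<in> free_module (basis F 0) \<and> \<pi> j f - aug_map F v \<in> I"
    using resolution_surj[OF F] by blast
  from choice[OF this] obtain v where v: "\<And>j. v j \<in> free_module (basis F 0)" "\<And>j. \<pi> j f - aug_map F (v j) \<in> I"
    by blast
  let ?J = "{j. \<pi> j f \<noteq> 0}"
  let ?u = "\<Sum>j\<in>?J. smult_vec (e j) (Poly_Mapping.map \<psi> (v j))"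
  have aug_\<psi>: "aug_map ?F (Poly_Mapping.map \<psi> w) = \<psi> (aug_map F w)" for w
  proof -
    have "Poly_Mapping.keys (Poly_Mapping.map \<psi> w) \<subseteq> Poly_Mapping.keys w"
      by (auto simp: in_keys_iff lookup_map ring_homD(1)[OF hom])
    then show ?thesis
      by (simp add: lookup_aug_map[of "Poly_Mapping.keys w"] lookup_map ring_homD[OF hom])
  qed
  have aug_sum: "aug_map ?F (sum g S) = (\<Sum>s\<in>S. aug_map ?F (g s))" for g and S :: "'j set"
    by (induction S rule: infinite_finite_induct) (auto simp: aug_map_add)
  have "f - aug_map ?F ?u = (\<Sum>j\<in>?J. e j * \<psi> (\<pi> j f)) - (\<Sum>j\<in>?J. e j * \<psi> (aug_map F (v j)))"
    by (simp only: coord_expand[of f, symmetric] aug_sum aug_map_smult aug_\<psi>)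
  also have "\<dots> = (\<Sum>j\<in>?J. e j * \<psi> (\<pi> j f - aug_map F (v j)))"
    by (simp add: ring_homD(5)[OF hom] right_diff_distrib sum_subtractf)
  also have "\<dots> \<in> extended_ideal \<psi> I"
    using extended_ideal_base[OF v(2), of \<psi>] extended_ideal_is_ideal[of \<psi> I]
    by (intro ideal_sum) (auto simp: is_ideal_def)
  finally have "f - aug_map ?F ?u \<in> extended_ideal \<psi> I" .
  moreover have "?u \<in> free_module (basis ?F 0)"
    using v(1) by (auto intro!: free_module_sum free_module_smult map_free_module simp: ring_homD(1)[OF hom])
  ultimately show "\<exists>v\<in>free_module (basis ?F 0). f - aug_map ?F v \<in> extended_ideal \<psi> I" by blast
qed

end

text \<open>All generators of the extended resolution have degrees divisible by \<open>m\<close>. In degree \<open>m j\<close> its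
  reduction to constant terms is the reduction of \<open>F\<close> in degree \<open>j\<close> with matrices moved by \<open>\<sigma>\<close>, so
  cycles and boundaries are again determined by coordinates, now over the field.\<close>

lemma betti_nonzero_extended:
  fixes I :: "('n::finite, 'k::field) mpoly set"
  assumes I: "homogeneous_ideal I" and \<sigma>: "ring_hom \<sigma>" and m: "m > 0"
  shows "betti (extended_ideal (power_map \<sigma> m) I) i j' \<noteq> 0 \<longleftrightarrow> (\<exists>j. j' = int m * j \<and> betti I i j \<noteq> 0)"
proof -
  obtain \<kappa> where K: "projective_extension \<sigma> (\<lambda>b. b) \<kappa>" by (rule field_projective_extension[OF \<sigma>])
  interpret K: projective_extension \<sigma> "\<lambda>b. b" \<kappa> by (rule K)
  define \<psi> :: "('n, 'k) mpoly \<Rightarrow> ('n, 'k) mpoly" where "\<psi> = power_map \<sigma> m"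
  obtain e \<pi> where E: "projective_extension \<psi> (e :: 'k \<times> ('n \<Rightarrow>\<^sub>0 nat) \<Rightarrow> ('n, 'k) mpoly) \<pi>"
    using power_map_projective_extension[OF \<sigma> m K] unfolding \<psi>_def by blast
  interpret E: graded_projective_extension \<psi> e \<pi> m
    using E power_map_form[OF \<sigma> m]
    by (auto simp: graded_projective_extension_def graded_projective_extension_axioms_def \<psi>_def)
  define J where "J = extended_ideal \<psi> I"
  have hJ: "homogeneous_ideal J" unfolding J_def by (rule E.extended_ideal_homogeneous[OF I])
  obtain F where F: "graded_free_resolution I F" "\<And>i j. finite {b\<in>basis F i. gdeg F i b = j}"
    using resolution_exists[OF I] by blast
  define F' where "F' = extend_complex \<psi> m F"
  have F': "graded_free_resolution J F'"
    unfolding J_def F'_def by (rule E.extend_resolution[OF I F(1)])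
  obtain L where L: "graded_free_resolution J L" "\<And>i j. finite {b\<in>basis L i. gdeg L i b = j}"
    using resolution_exists[OF hJ] by blast
  have bI: "betti I i j \<noteq> 0 \<longleftrightarrow> \<not> tor_cycles F i j \<subseteq> tor_boundaries F i j" for j
    by (rule betti_nonzero_iff[OF I F(1) F(1) F(2)])
  have bJ: "betti J i j' \<noteq> 0 \<longleftrightarrow> \<not> tor_cycles F' i j' \<subseteq> tor_boundaries F' i j'"
    by (rule betti_nonzero_iff[OF hJ F' L(1) L(2)])
  have "tor_cycles F' i j' \<subseteq> tor_boundaries F' i j' \<longleftrightarrow>
      (\<forall>j. j' = int m * j \<longrightarrow> tor_cycles F i j \<subseteq> tor_boundaries F i j)"
  proof (cases "\<exists>j. j' = int m * j")
    case False
    then have "{b \<in> basis F i. int m * gdeg F i b = j'} = {}" by auto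
    then have "tensor_part F' i j' = free_module {}"
      by (simp only: tensor_part_def F'_def extend_complex_simps)
    also have "free_module {} = {0 :: nat \<Rightarrow>\<^sub>0 'k}" by (auto simp: free_module_def)
    finally have "tensor_part F' i j' = {0}" .
    then have "tor_cycles F' i j' \<subseteq> {0}" by (auto simp: tor_cycles_def split: nat.splits)
    then show ?thesis using False subspace_tor_boundaries[of F' i j'] by (auto simp: vec_subspace_def)
  next
    case True
    then obtain j where j: "j' = int m * j" by blast
    have j_unique: "j' = int m * k \<longleftrightarrow> k = j" for k using m j by auto
    have part: "tensor_part F' i j' = tensor_part F i j" for i
      using m by (simp add: tensor_part_def F'_def j)
    have diff: "tensor_diff F' i = lin_ext (\<lambda>b. Poly_Mapping.map \<sigma> (bar (diff F i b)))" for i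
    proof -
      have "bar (Poly_Mapping.map \<psi> v) = Poly_Mapping.map \<sigma> (bar v)" for v :: "nat \<Rightarrow>\<^sub>0 ('n, 'k) mpoly"
        by (rule poly_mapping_eqI)
          (simp add: lookup_map ring_homD(1)[OF E.hom] ring_homD(1)[OF \<sigma>] \<psi>_def const_term_power_map[OF \<sigma> m]
            ring_homD(1)[OF power_map_hom[OF \<sigma> m]])
      then show ?thesis by (simp add: tensor_diff_def F'_def)
    qed
    have part_coords: "v \<in> tensor_part F i j \<longleftrightarrow> (\<forall>l. Poly_Mapping.map (\<kappa> l) v \<in> tensor_part F i j)" for v i
      unfolding tensor_part_def by (rule K.free_module_iff_coords)
    have cycles: "v \<in> tor_cycles F' i j' \<longleftrightarrow> (\<forall>l. Poly_Mapping.map (\<kappa> l) v \<in> tor_cycles F i j)" for v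
    proof (cases i)
      case 0
      then show ?thesis using part_coords[of v 0] part[of 0] by (simp add: tor_cycles_def)
    next
      case (Suc i')
      have "tensor_diff F' i' v = 0 \<longleftrightarrow> (\<forall>l. tensor_diff F i' (Poly_Mapping.map (\<kappa> l) v) = 0)"
        unfolding diff by (subst K.kernel_iff_coords) (simp add: tensor_diff_def)
      then show ?thesis using Suc part_coords[of v i] part[of i] by (auto simp: tor_cycles_def)
    qed
    have boundaries: "v \<in> tor_boundaries F' i j' \<longleftrightarrow> (\<forall>l. Poly_Mapping.map (\<kappa> l) v \<in> tor_boundaries F i j)" for v
      unfolding tor_boundaries_def part diff unfolding tensor_part_def tensor_diff_def by (rule K.lin_ext_image_iff_coords)
    have "tor_cycles F i j \<subseteq> tor_boundaries F i j" if sub: "tor_cycles F' i j' \<subseteq> tor_boundaries F' i j'"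
    proof
      fix v assume v: "v \<in> tor_cycles F i j"
      \<comment> \<open>The coordinates of \<open>\<sigma> v\<close> are the multiples of \<open>v\<close> by the coordinates of \<open>1\<close>; a nonzero one
        recovers \<open>v\<close>.\<close>
      have "\<exists>l. \<kappa> l 1 \<noteq> 0" using K.eq_0_iff_coords[of 1] by auto
      then obtain l where l: "\<kappa> l 1 \<noteq> 0" by blast
      have c: "Poly_Mapping.map (\<kappa> k) (Poly_Mapping.map \<sigma> v) = smult_vec (\<kappa> k 1) v" for k
        by (rule poly_mapping_eqI)
          (use K.coord_mult[of k _ 1] in \<open>simp add: lookup_map K.coord_zero ring_homD(1)[OF \<sigma>] mult.commute\<close>)
      have "Poly_Mapping.map \<sigma> v \<in> tor_cycles F' i j'"
        unfolding cycles c using v subspace_tor_cycles[of F i j] by (auto intro: vec_subspace_smult)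
      then have "smult_vec (\<kappa> l 1) v \<in> tor_boundaries F i j" using sub boundaries c by auto
      then have "smult_vec (inverse (\<kappa> l 1)) (smult_vec (\<kappa> l 1) v) \<in> tor_boundaries F i j"
        by (rule vec_subspace_smult[OF subspace_tor_boundaries])
      then show "v \<in> tor_boundaries F i j" using l by (simp add: smult_vec_alg)
    qed
    moreover have "tor_cycles F' i j' \<subseteq> tor_boundaries F' i j'" if "tor_cycles F i j \<subseteq> tor_boundaries F i j"
      using that cycles boundaries by blast
    ultimately have "tor_cycles F' i j' \<subseteq> tor_boundaries F' i j' \<longleftrightarrow> tor_cycles F i j \<subseteq> tor_boundaries F i j" by blast
    then show ?thesis unfolding j_unique by simp
  qed
  then have "betti J i j' \<noteq> 0 \<longleftrightarrow> (\<exists>j. j' = int m * j \<and> betti I i j \<noteq> 0)"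
    using bI bJ by blast
  then show ?thesis by (simp add: J_def \<psi>_def)
qed

section \<open>Square powers and Frobenius powers\<close>

lemma prod_Var_power:
  "(\<Prod>x\<in>S. (Var x ^ m) ^ k x) = (Poly_Mapping.single (\<Sum>x\<in>S. Poly_Mapping.single x (m * k x)) 1 :: ('n::finite, 'k::field) mpoly)"
proof -
  have Var: "(Var x :: ('n, 'k) mpoly) ^ l = Poly_Mapping.single (Poly_Mapping.single x l) 1" for x l
    by (induction l) (simp_all add: Var_def mult_single single_add[symmetric])
  have "((Var x :: ('n, 'k) mpoly) ^ m) ^ l = Poly_Mapping.single (Poly_Mapping.single x (m * l)) 1" for x l
    unfolding power_mult[symmetric] by (rule Var)
  then show ?thesis
    by (induction S rule: infinite_finite_induct) (simp_all add: mult_single del: power_mult)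
qed

lemma subst_power: "subst (\<lambda>x. Var x ^ m) f = power_map (\<lambda>c. c) m f"
proof -
  have "(\<Sum>x\<in>UNIV. Poly_Mapping.single x (m * Poly_Mapping.lookup t x)) = mscale m t" for t :: "'a \<Rightarrow>\<^sub>0 nat"
    by (rule poly_mapping_eqI) (simp add: lookup_sum lookup_single when_def lookup_mscale)
  then show ?thesis
    by (simp add: subst_def power_map_def mono_ext_def prod_Var_power Const_def mult_single)
qed

lemma square_power_eq: "square_power m I = extended_ideal (power_map (\<lambda>c. c) m) I"
  by (simp add: extended_ideal_def square_power_def subst_power Setcompr_eq_image)

lemma CHAR_mpoly:
  assumes "CHAR('k::field) = p"
  shows "CHAR(('n, 'k) mpoly) = p"
proof (rule CHAR_eqI)
  have of_nat: "(of_nat c :: ('n, 'k) mpoly) = Poly_Mapping.single 0 (of_nat c)" for c by simp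
  show "(of_nat p :: ('n, 'k) mpoly) = 0"
    using assms of_nat_CHAR[where ?'a='k] by (simp add: of_nat)
  show "p dvd c" if "(of_nat c :: ('n, 'k) mpoly) = 0" for c
  proof -
    have "Poly_Mapping.lookup (of_nat c :: ('n, 'k) mpoly) 0 = 0" using that by simp
    then have "(of_nat c :: 'k) = 0" by (simp add: lookup_of_nat)
    then show ?thesis using assms by (simp add: of_nat_eq_0_iff_char_dvd)
  qed
qed

lemma ring_hom_frobenius:
  assumes "CHAR('k::field) = p" "p > 0"
  shows "ring_hom (\<lambda>c::'k. c ^ p ^ e)"
proof -
  have "prime p" using assms prime_CHAR_semidom[where ?'a='k] by simp
  then show ?thesis using assms(1)
    by (simp add: ring_hom_def power_mult_distrib freshmans_dream')
qed

text \<open>Both sides are additive, the left one by the binomial theorem in characteristic \<open>p\<close>, and they agree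
  on monomials.\<close>

lemma power_eq_power_map:
  fixes f :: "('n::finite, 'k::field) mpoly"
  assumes "CHAR('k) = p" "p > 0"
  shows "f ^ p ^ e = power_map (\<lambda>c. c ^ p ^ e) (p ^ e) f"
proof (rule additive_eqI[where F="\<lambda>f. f ^ p ^ e"])
  have p: "prime p" using assms prime_CHAR_semidom[where ?'a='k] by simp
  show "(x + y) ^ p ^ e = x ^ p ^ e + y ^ p ^ e" for x y :: "('n, 'k) mpoly"
    using p by (simp add: freshmans_dream' CHAR_mpoly[OF assms(1)])
  have hom: "ring_hom (\<lambda>c::'k. c ^ p ^ e)" by (rule ring_hom_frobenius[OF assms])
  have pos: "p ^ e > 0" using assms(2) by simp
  show "power_map (\<lambda>c. c ^ p ^ e) (p ^ e) (x + y) =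
      power_map (\<lambda>c. c ^ p ^ e) (p ^ e) x + power_map (\<lambda>c. c ^ p ^ e) (p ^ e) y" for x y :: "('n, 'k) mpoly"
    by (rule power_map_add[OF hom pos])
  have "Poly_Mapping.single t c ^ l = Poly_Mapping.single (mscale l t) (c ^ l)" for t :: "'n \<Rightarrow>\<^sub>0 nat" and c :: 'k and l
  proof (induction l)
    case 0
    have "mscale 0 t = 0" by (rule poly_mapping_eqI) (simp add: lookup_mscale)
    then show ?case by simp
  next
    case (Suc l)
    have "t + mscale l t = mscale (Suc l) t" by (rule poly_mapping_eqI) (simp add: lookup_mscale lookup_add)
    then show ?case using Suc by (simp add: mult_single)
  qed
  then show "Poly_Mapping.single t c ^ p ^ e = power_map (\<lambda>c. c ^ p ^ e) (p ^ e) (Poly_Mapping.single t c)"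
    for t :: "'n \<Rightarrow>\<^sub>0 nat" and c :: 'k
    by (simp add: power_map_single[OF hom pos])
qed

lemma frobenius_power_eq:
  assumes "CHAR('k) = p" "p > 0"
  shows "frobenius_power (p ^ e) (I :: ('n::finite, 'k::field) mpoly set) =
    extended_ideal (power_map (\<lambda>c. c ^ p ^ e) (p ^ e)) I"
  by (simp add: extended_ideal_def frobenius_power_def power_eq_power_map[OF assms] Setcompr_eq_image)

section \<open>Regularity\<close>

text \<open>The value is attained at the extremal pair \<open>(i, i + r)\<close>, which moves to \<open>(i, m (i + r))\<close>.\<close>

lemma regularity_extended:
  fixes I :: "('n::finite, 'k::field) mpoly set"
  assumes I: "homogeneous_ideal I" and r: "regularity I = ereal (real_of_int r)"
    and ext: "extremal_betti I i (int i + r)" and \<sigma>: "ring_hom \<sigma>" and m: "m > 0"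
  shows "regularity (extended_ideal (power_map \<sigma> m) I) = ereal (real_of_int (int m * r + (int m - 1) * int i))"
proof -
  let ?J = "extended_ideal (power_map \<sigma> m) I"
  have le: "l - int k \<le> r" if "betti I k l \<noteq> 0" for k l
  proof -
    have "ereal (real_of_int (l - int k)) \<le> regularity I"
      unfolding regularity_def using that by (intro Sup_upper) auto
    then show ?thesis by (simp add: r)
  qed
  have bound: "int m * l - int k \<le> int m * r + (int m - 1) * int i" if b: "betti I k l \<noteq> 0" for k l
  proof (cases "k \<le> i")
    case True
    have "int m * l \<le> int m * (int k + r)" using le[OF b] by (intro mult_left_mono) auto
    moreover have "(int m - 1) * int k \<le> (int m - 1) * int i" using True m by (intro mult_left_mono) auto
    ultimately show ?thesis by (simp add: algebra_simps)
  next
    case False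
    have "l < int i + r"
    proof (rule ccontr)
      assume "\<not> l < int i + r"
      then have "k \<ge> i \<and> l \<ge> int i + r \<and> (k, l) \<noteq> (i, int i + r)" using False by auto
      then have "betti I k l = 0" using ext unfolding extremal_betti_def by blast
      then show False using b by simp
    qed
    then have "int m * l \<le> int m * (int i + r)" by (intro mult_left_mono) auto
    then show ?thesis using False by (simp add: algebra_simps)
  qed
  have nz: "betti ?J i (int m * (int i + r)) \<noteq> 0"
    unfolding betti_nonzero_extended[OF I \<sigma> m] using ext by (auto simp: extremal_betti_def)
  show ?thesis
    unfolding regularity_def
  proof (rule antisym)
    show "Sup {ereal (real_of_int (j - int i)) | i j. betti ?J i j \<noteq> 0} \<le> ereal (real_of_int (int m * r + (int m - 1) * int i))"
    proof (rule Sup_least)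
      fix x assume "x \<in> {ereal (real_of_int (j - int i)) | i j. betti ?J i j \<noteq> 0}"
      then obtain k l where x: "x = ereal (real_of_int (l - int k))" and "betti ?J k l \<noteq> 0" by blast
      then obtain l' where "l = int m * l'" "betti I k l' \<noteq> 0" unfolding betti_nonzero_extended[OF I \<sigma> m] by blast
      then show "x \<le> ereal (real_of_int (int m * r + (int m - 1) * int i))"
        using bound[of k l'] by (simp only: x ereal_less_eq of_int_le_iff simp_thms)
    qed
    show "ereal (real_of_int (int m * r + (int m - 1) * int i)) \<le> Sup {ereal (real_of_int (j - int i)) | i j. betti ?J i j \<noteq> 0}"
      using nz by (intro Sup_upper CollectI exI[of _ i] exI[of _ "int m * (int i + r)"]) (simp add: algebra_simps)
  qed
qed

theorem corollary2p13:
  fixes I :: "('n::finite, 'k::field) mpoly set"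
    and r :: int and i :: nat
  assumes "homogeneous_ideal I"
    and "regularity I = ereal (real_of_int r)"
    and "extremal_betti I i (int i + r)"
  shows "(\<forall>i'. extremal_betti I i' (int i' + r) \<longrightarrow> i' = i) \<and>
    (\<forall>m::nat. m \<ge> 2 \<longrightarrow>
      regularity (square_power m I) = ereal (real_of_int (int m * r + (int m - 1) * int i))) \<and>
    (\<forall>p e::nat. CHAR('k) = p \<and> p > 0 \<and> e \<ge> 1 \<longrightarrow>
      regularity (frobenius_power (p ^ e) I) =
        ereal (real_of_int (int p ^ e * r + (int p ^ e - 1) * int i)))"
proof (intro conjI allI impI)
  fix i' assume i': "extremal_betti I i' (int i' + r)"
  show "i' = i"
  proof (rule ccontr)
    assume "i' \<noteq> i"
    then consider "i < i'" | "i' < i" by linarith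
    then show False
      using assms(3) i' unfolding extremal_betti_def by cases force+
  qed
next
  fix m :: nat assume "m \<ge> 2"
  then show "regularity (square_power m I) = ereal (real_of_int (int m * r + (int m - 1) * int i))"
    unfolding square_power_eq by (intro regularity_extended assms) (auto simp: ring_hom_def)
next
  fix p e :: nat assume p: "CHAR('k) = p \<and> p > 0 \<and> e \<ge> 1"
  then have "ring_hom (\<lambda>c::'k. c ^ p ^ e)" by (intro ring_hom_frobenius) auto
  from regularity_extended[OF assms this, of "p ^ e"] p
  show "regularity (frobenius_power (p ^ e) I) = ereal (real_of_int (int p ^ e * r + (int p ^ e - 1) * int i))"
    by (simp add: frobenius_power_eq)
qed

end
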